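(* Let $A$ be a finite alphabet and let $\sigma\colon A^*\to A^*$ be a morphism such that the shift space $X(\sigma)$ is minimal and aperiodic. Then $\sigma$ is almost one-sided recognizable on $X(\sigma)^+$; that is, $\sigma$ is one-sided recognizable on $X(\sigma)^+$ at every $y\in A^{\mathbb N}$ except at a finite number of points $y\in A^{\mathbb N}$.
   Context: $S$ denotes the shift transformation, $S(x)_n=x_{n+1}$, on $A^{\mathbb Z}$ or $A^{\mathbb N}$. A shift space is a closed subset $X$ of $A^{\mathbb Z}$ with $S(X)=X$. For $x\in A^{\mathbb Z}$, $x^+=x_0x_1\cdots$, and $X^+=\{x^+\mid x\in X\}$. For a morphism $\sigma\colon A^*\to A^*$ (possibly erasing letters), $\mathcal L(\sigma)$ is the set of factors of the words $\sigma^n(a)$, $n\ge0$, $a\in A$, and $X(\sigma)$ is the set of $x\in A^{\mathbb Z}$ all of whose factors are in $\mathcal L(\sigma)$. A shift space $X$ is minimal if it is nonempty and every closed subset $Y\subseteq X$ with $S(Y)\subseteq Y$ is $\emptyset$ or $X$. A sequence is periodic if $S^n(x)=x$ for some $n\ge1$ and aperiodic otherwise; a shift space is aperiodic if all its elements are aperiodic. The morphism $\sigma$ extends to one-sided sequences by $\sigma(x)=\sigma(x_0)\sigma(x_1)\cdots$. A $\sigma$-representation of $y\in A^{\mathbb N}$ is a pair $(x,k)$ with $x\in A^{\mathbb N}$, $0\le k<|\sigma(x_0)|$ and $y=S^k(\sigma(x))$. The morphism $\sigma$ is one-sided recognizable on a one-sided shift $Z\subseteq A^{\mathbb N}$ at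 $y$ if $y$ has at most one $\sigma$-representation $(x,k)$ with $x\in Z$. *)

theory Defs
  imports "HOL-Analysis.Analysis" "HOL-Library.Sublist"
begin

text \<open>The finite alphabet is a type of class \<open>finite\<close>; two-sided and one-sided sequences are
  functions on \<^typ>\<open>int\<close> and \<^typ>\<open>nat\<close>, and the shift is defined for both index types at once.\<close>

definition seq_shift :: "('i::{plus,one} \<Rightarrow> 'a) \<Rightarrow> 'i \<Rightarrow> 'a" where
  "seq_shift x n = x (n + 1)"

definition fullshift_topology :: "(int \<Rightarrow> 'a) topology" where
  "fullshift_topology = product_topology (\<lambda>_. discrete_topology UNIV) UNIV"

definition shift_space :: "(int \<Rightarrow> 'a) set \<Rightarrow> bool" where
  "shift_space X \<longleftrightarrow> closedin fullshift_topology X \<and> seq_shift ` X = X"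

definition minimal_shift :: "(int \<Rightarrow> 'a) set \<Rightarrow> bool" where
  "minimal_shift X \<longleftrightarrow> shift_space X \<and> X \<noteq> {} \<and>
     (\<forall>Y. Y \<subseteq> X \<and> closedin fullshift_topology Y \<and> seq_shift ` Y \<subseteq> Y \<longrightarrow> Y = {} \<or> Y = X)"

definition periodic_seq :: "('i::{plus,one} \<Rightarrow> 'a) \<Rightarrow> bool" where
  "periodic_seq x \<longleftrightarrow> (\<exists>n\<ge>1. (seq_shift ^^ n) x = x)"

definition aperiodic_shift :: "(int \<Rightarrow> 'a) set \<Rightarrow> bool" where
  "aperiodic_shift X \<longleftrightarrow> (\<forall>x\<in>X. \<not> periodic_seq x)"

definition right_half :: "(int \<Rightarrow> 'a) \<Rightarrow> nat \<Rightarrow> 'a" where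
  "right_half x n = x (int n)"

definition word_morphism :: "('a list \<Rightarrow> 'b list) \<Rightarrow> bool" where
  "word_morphism \<sigma> \<longleftrightarrow> (\<forall>u v. \<sigma> (u @ v) = \<sigma> u @ \<sigma> v)"

definition morphism_language :: "('a list \<Rightarrow> 'a list) \<Rightarrow> 'a list set" where
  "morphism_language \<sigma> = {w. \<exists>n a. sublist w ((\<sigma> ^^ n) [a])}"

definition morphism_shift :: "('a list \<Rightarrow> 'a list) \<Rightarrow> (int \<Rightarrow> 'a) set" where
  "morphism_shift \<sigma> =
     {x. \<forall>i n. map (\<lambda>j. x (i + int j)) [0..<n] \<in> morphism_language \<sigma>}"

text \<open>As \<open>\<sigma>\<close> may erase letters, \<open>\<sigma>(x\<^sub>0)\<sigma>(x\<^sub>1)\<dots>\<close> can be a finite word. The relation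
  \<open>seq_image \<sigma> x z\<close> says that this concatenation is infinite and equal to the sequence \<open>z\<close>;
  when the concatenation is finite, \<open>x\<close> has no image among the one-sided sequences.\<close>

definition image_prefix :: "('a list \<Rightarrow> 'b list) \<Rightarrow> (nat \<Rightarrow> 'a) \<Rightarrow> nat \<Rightarrow> 'b list" where
  "image_prefix \<sigma> x n = concat (map (\<lambda>i. \<sigma> [x i]) [0..<n])"

definition seq_image :: "('a list \<Rightarrow> 'b list) \<Rightarrow> (nat \<Rightarrow> 'a) \<Rightarrow> (nat \<Rightarrow> 'b) \<Rightarrow> bool" where
  "seq_image \<sigma> x z \<longleftrightarrow>
     (\<forall>m. \<exists>n. m \<le> length (image_prefix \<sigma> x n)) \<and>
     (\<forall>n. image_prefix \<sigma> x n = map z [0..<length (image_prefix \<sigma> x n)])"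

definition sigma_representation ::
  "('a list \<Rightarrow> 'b list) \<Rightarrow> (nat \<Rightarrow> 'b) \<Rightarrow> (nat \<Rightarrow> 'a) \<times> nat \<Rightarrow> bool" where
  "sigma_representation \<sigma> y = (\<lambda>(x, k).
     k < length (\<sigma> [x 0]) \<and> (\<exists>z. seq_image \<sigma> x z \<and> y = (seq_shift ^^ k) z))"

definition one_sided_recognizable_at ::
  "('a list \<Rightarrow> 'b list) \<Rightarrow> (nat \<Rightarrow> 'a) set \<Rightarrow> (nat \<Rightarrow> 'b) \<Rightarrow> bool" where
  "one_sided_recognizable_at \<sigma> Z y \<longleftrightarrow>
     (\<forall>x\<in>Z. \<forall>x'\<in>Z. \<forall>k k'. sigma_representation \<sigma> y (x, k) \<and> sigma_representation \<sigma> y (x', k')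
        \<longrightarrow> (x, k) = (x', k'))"

definition almost_one_sided_recognizable ::
  "('a list \<Rightarrow> 'b list) \<Rightarrow> (nat \<Rightarrow> 'a) set \<Rightarrow> bool" where
  "almost_one_sided_recognizable \<sigma> Z \<longleftrightarrow> finite {y. \<not> one_sided_recognizable_at \<sigma> Z y}"

text \<open>The condition \<^const>\<open>shift_space\<close> inside \<^const>\<open>minimal_shift\<close> is no restriction on
  \<open>X(\<sigma>)\<close>:\<close>

lemma shift_space_morphism_shift: "shift_space (morphism_shift \<sigma>)"
proof -
  let ?T = "fullshift_topology :: (int \<Rightarrow> 'a) topology"
  have top: "topspace ?T = UNIV"
    by (simp add: fullshift_topology_def)
  have "closedin ?T (morphism_shift \<sigma>)"
    unfolding closedin_def
  proof
    show "morphism_shift \<sigma> \<subseteq> topspace ?T" by (simp add: top)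
    show "openin ?T (topspace ?T - morphism_shift \<sigma>)"
      unfolding openin_subopen[of _ "topspace ?T - morphism_shift \<sigma>"]
    proof
      fix x assume "x \<in> topspace ?T - morphism_shift \<sigma>"
      then obtain i n where bad: "map (\<lambda>j. x (i + int j)) [0..<n] \<notin> morphism_language \<sigma>"
        by (auto simp: morphism_shift_def)
      define U where "U = (\<Pi>\<^sub>E k\<in>UNIV. if k \<in> {i..<i + int n} then {x k} else UNIV)"
      have "openin ?T U"
        unfolding U_def fullshift_topology_def
        by (rule product_topology_basis) (auto intro: finite_subset[of _ "{i..<i + int n}"])
      moreover have "x \<in> U" by (auto simp: U_def)
      moreover have "U \<subseteq> topspace ?T - morphism_shift \<sigma>"
      proof
        fix y assume "y \<in> U"
        then have "y k = x k" if "k \<in> {i..<i + int n}" for k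
          using that by (auto simp: U_def PiE_iff split: if_splits dest: spec[of _ k])
        then have "map (\<lambda>j. y (i + int j)) [0..<n] = map (\<lambda>j. x (i + int j)) [0..<n]"
          by auto
        with bad show "y \<in> topspace ?T - morphism_shift \<sigma>"
          unfolding top morphism_shift_def by (metis (no_types, lifting) DiffI UNIV_I mem_Collect_eq)
      qed
      ultimately show "\<exists>U. openin ?T U \<and> x \<in> U \<and> U \<subseteq> topspace ?T - morphism_shift \<sigma>"
        by blast
    qed
  qed
  moreover have "seq_shift ` morphism_shift \<sigma> = morphism_shift \<sigma>"
  proof
    have eq: "(\<lambda>j. seq_shift x (i + int j)) = (\<lambda>j. x ((i + 1) + int j))" for x :: "int \<Rightarrow> 'a" and i
      by (simp add: seq_shift_def algebra_simps)
    show "seq_shift ` morphism_shift \<sigma> \<subseteq> morphism_shift \<sigma>"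
      by (auto simp: morphism_shift_def eq)
    show "morphism_shift \<sigma> \<subseteq> seq_shift ` morphism_shift \<sigma>"
    proof
      fix x assume x: "x \<in> morphism_shift \<sigma>"
      define y where "y k = x (k - 1)" for k
      have "(\<lambda>j. y (i + int j)) = (\<lambda>j. x ((i - 1) + int j))" for i
        by (simp add: y_def algebra_simps)
      then have "y \<in> morphism_shift \<sigma>"
        using x by (simp add: morphism_shift_def)
      moreover have "x = seq_shift y"
        by (simp add: seq_shift_def y_def fun_eq_iff)
      ultimately show "x \<in> seq_shift ` morphism_shift \<sigma>" by blast
    qed
  qed
  ultimately show ?thesis by (simp add: shift_space_def)
qed

end

theory Submission
  imports Defs
begin

text \<open>Assume that \<open>\<sigma>\<close> does not erase all letters of \<open>X = X(\<sigma>)\<close>; otherwise there are no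
  representations at all. Then every point of \<open>X\<close> is, up to a shift, the image under \<open>\<sigma>\<^sup>n\<close> of a
  point of \<open>X\<close>.

  Two-sided recognizability: suppose that \<open>\<sigma>(x)\<close> and \<open>\<sigma>(x')\<close> lie in the same orbit. Write \<open>x\<close> and
  \<open>x'\<close> as \<open>\<sigma>\<^sup>n(v\<^sub>n)\<close> and \<open>\<sigma>\<^sup>n(v'\<^sub>n)\<close>, which gives two factorizations of the same sequence into images
  of letters under \<open>\<sigma>\<^sup>n\<^sup>+\<^sup>1\<close>. A window of \<open>v\<^sub>n\<close> together with the facing window of \<open>v'\<^sub>n\<close>, both of a
  length that does not depend on \<open>n\<close>, determines the relative position of the two factorizations: two
  different positions would give a word of small period \<open>p\<close> that contains all words of length \<open>p\<close> of
  \<open>X\<close>, and \<open>X\<close> would be periodic. The set of pairs of consecutive windows takes only finitely many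
  values as \<open>n\<close> varies. If it is the same for some \<open>n < m\<close>, the positions at level \<open>n\<close> show that the
  images of \<open>v\<^sub>m\<close> and \<open>v'\<^sub>m\<close> under \<open>\<sigma>\<^sup>n\<^sup>+\<^sup>1\<close>, hence also under \<open>\<sigma>\<^sup>m\<close>, lie in the same orbit, so \<open>x\<close> and
  \<open>x'\<close> do.

  By compactness a window of \<open>\<sigma>(x)\<close> of fixed length determines \<open>x\<close> locally, so two representations of
  a one-sided sequence merge at a bounded position. If they are different, the sequence from the merging
  point on is left special. There are finitely many left special sequences since \<open>X\<close> has linear
  complexity, for which \<open>\<sigma>\<close> has to grow on some letter of \<open>X\<close>. It does, because arbitrarily long words
  over bounded letters in \<open>L(\<sigma>)\<close> would produce arbitrarily high powers of a word, hence a periodic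
  point.\<close>

section \<open>Two-sided sequences and their images\<close>

definition seg :: "(int \<Rightarrow> 'a) \<Rightarrow> int \<Rightarrow> int \<Rightarrow> 'a list" where
  "seg x a b = map x [a..b - 1]"

lemma length_seg [simp]: "length (seg x a b) = nat (b - a)"
  by (simp add: seg_def)

lemma seg_empty [simp]: "b \<le> a \<Longrightarrow> seg x a b = []"
  by (simp add: seg_def)

lemma nth_seg: "n < nat (b - a) \<Longrightarrow> seg x a b ! n = x (a + int n)"
  by (simp add: seg_def)

lemma seg_append: "a \<le> b \<Longrightarrow> b \<le> c \<Longrightarrow> seg x a c = seg x a b @ seg x b c"
  unfolding seg_def using upto_split1[of a b "c - 1"]
  by (cases "b = c") (auto simp: map_append[symmetric] simp del: map_append)

lemma seg_single [simp]: "seg x a (a + 1) = [x a]"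
  by (simp add: seg_def)

lemma seg_Cons: "a < b \<Longrightarrow> seg x a b = x a # seg x (a + 1) b"
  using seg_append[of a "a + 1" b x] by simp

lemma seg_eq_iff:
  "seg x a b = seg y c d \<longleftrightarrow>
     nat (b - a) = nat (d - c) \<and> (\<forall>n. int n < b - a \<longrightarrow> x (a + int n) = y (c + int n))"
  by (auto simp: list_eq_iff_nth_eq nth_seg zless_nat_eq_int_zless)

lemma seg_eqI:
  assumes "b - a = d - c" "\<And>i. a \<le> i \<Longrightarrow> i < b \<Longrightarrow> x i = y (i + (c - a))"
  shows "seg x a b = seg y c d"
proof -
  have "x (a + int n) = y (c + int n)" if "int n < b - a" for n
    using assms(2)[of "a + int n"] that by (simp add: algebra_simps)
  then show ?thesis using assms(1) by (auto simp: seg_eq_iff)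
qed

lemma seg_eqD:
  assumes "seg x a b = seg y c d" "a \<le> i" "i < b"
  shows "x i = y (i + (c - a))"
  using assms(2,3) assms(1)[unfolded seg_eq_iff, THEN conjunct2, rule_format, of "nat (i - a)"]
  by (simp add: algebra_simps)

lemma seg_shift: "seg (\<lambda>i. x (i + d)) a b = seg x (a + d) (b + d)"
  by (rule seg_eqI) (auto simp: algebra_simps)

lemma sublist_seg:
  assumes "a' \<le> a" "a \<le> b" "b \<le> b'"
  shows "sublist (seg x a b) (seg x a' b')"
  using seg_append[of a' a b' x] seg_append[of a b b' x] assms
  by (simp add: sublist_appendI)

lemma take_drop_seg:
  assumes "a \<le> c" "c \<le> d" "d \<le> b"
  shows "take (nat (d - c)) (drop (nat (c - a)) (seg x a b)) = seg x c d"
  using seg_append[of a c b x] seg_append[of c d b x] assms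
  by simp

section \<open>Word morphisms and lengths of images\<close>

lemma word_morphism_Nil: "word_morphism f \<Longrightarrow> f [] = []"
  unfolding word_morphism_def by (metis append_Nil append_self_conv)

lemma word_morphism_append: "word_morphism f \<Longrightarrow> f (u @ v) = f u @ f v"
  by (simp add: word_morphism_def)

lemma word_morphism_funpow:
  fixes f :: "'a list \<Rightarrow> 'a list"
  shows "word_morphism f \<Longrightarrow> word_morphism (f ^^ n)"
  by (induction n) (auto simp: word_morphism_def)

lemma word_morphism_concat:
  assumes "word_morphism f" shows "f w = concat (map (\<lambda>a. f [a]) w)"
proof (induction w)
  case Nil
  then show ?case using word_morphism_Nil[OF assms] by simp
next
  case (Cons a w)
  then show ?case using word_morphism_append[OF assms, of "[a]" w] by simp
qed

lemma word_morphism_sublist: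
  assumes "word_morphism f" "sublist u v" shows "sublist (f u) (f v)"
  using assms unfolding sublist_def by (metis word_morphism_append)

lemma length_word_morphism_le:
  assumes "word_morphism f" "\<And>a. a \<in> set w \<Longrightarrow> length (f [a]) \<le> M"
  shows "length (f w) \<le> length w * M"
  using assms(2)
proof (induction w)
  case (Cons a w)
  then show ?case using word_morphism_append[OF assms(1), of "[a]" w] by fastforce
qed (simp add: word_morphism_Nil[OF assms(1)])

lemma word_morphism_member_le:
  assumes "word_morphism f" "a \<in> set w"
  shows "length (f [a]) \<le> length (f w)"
proof -
  obtain u v where "w = u @ [a] @ v" using assms(2) by (metis append_Cons append_Nil in_set_conv_decomp)
  then show ?thesis by (simp only: word_morphism_append[OF assms(1)] length_append)
qed

text \<open>Two-sided images up to a shift: \<open>y\<close> is the concatenation of the words \<open>f(x\<^sub>i)\<close>, and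
  \<open>P i\<close> is the position in \<open>y\<close> at which \<open>f(x\<^sub>i)\<close> starts.\<close>

definition img :: "('a list \<Rightarrow> 'b list) \<Rightarrow> (int \<Rightarrow> 'a) \<Rightarrow> (int \<Rightarrow> int) \<Rightarrow> (int \<Rightarrow> 'b) \<Rightarrow> bool" where
  "img f x P y \<longleftrightarrow> (\<forall>i. P i \<le> P (i + 1) \<and> seg y (P i) (P (i + 1)) = f [x i]) \<and>
     (\<forall>m. \<exists>i. m < P i) \<and> (\<forall>m. \<exists>i. P i < m)"

lemma img_le_step: "img f x P y \<Longrightarrow> P i \<le> P (i + 1)"
  by (simp add: img_def)

lemma img_block: "img f x P y \<Longrightarrow> seg y (P i) (P (i + 1)) = f [x i]"
  by (simp add: img_def)

lemma img_step: "img f x P y \<Longrightarrow> P (i + 1) = P i + int (length (f [x i]))"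
  using img_le_step[of f x P y i] arg_cong[OF img_block[of f x P y i], of length] by simp

lemma img_mono:
  assumes "img f x P y" "i \<le> j" shows "P i \<le> P j"
  using assms(2)
proof (induction j rule: int_ge_induct)
  case (step j)
  then show ?case using img_le_step[OF assms(1), of j] by linarith
qed simp

lemma img_less_cancel: "img f x P y \<Longrightarrow> P i < P j \<Longrightarrow> i < j"
  using img_mono[of f x P y j i] by force

lemma img_seg:
  assumes "img f x P y" "word_morphism f" "i \<le> j"
  shows "seg y (P i) (P j) = f (seg x i j)"
  using assms(3)
proof (induction j rule: int_ge_induct)
  case base
  then show ?case by (simp add: word_morphism_Nil[OF assms(2)])
next
  case (step j)
  have "seg y (P i) (P (j + 1)) = seg y (P i) (P j) @ seg y (P j) (P (j + 1))"
    by (rule seg_append) (use img_mono[OF assms(1)] step.hyps in auto)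
  also have "\<dots> = f (seg x i j @ [x j])"
    by (simp add: step.IH img_block[OF assms(1)] word_morphism_append[OF assms(2)])
  also have "seg x i j @ [x j] = seg x i (j + 1)"
    using seg_append[of i j "j + 1" x] step.hyps by simp
  finally show ?case .
qed

lemma img_diff:
  assumes "img f x P y" "word_morphism f" "i \<le> j"
  shows "P j = P i + int (length (f (seg x i j)))"
  using arg_cong[OF img_seg[OF assms], of length] img_mono[OF assms(1,3)] by simp

text \<open>Cuts are unbounded on both sides, so to the right of a cut before \<open>t\<close> there
  is a first cut beyond \<open>t\<close>, and the block ending there contains \<open>t\<close>.
  Erased letters give empty blocks, so several indices may share a cut, but the block found here is
  nonempty.\<close>

lemma img_blockE:
  assumes "img f x P y"
  obtains j where "P j \<le> t" "t < P (j + 1)"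
proof -
  obtain a b where a: "P a < t" and b: "t < P b"
    using assms unfolding img_def by meson
  have ab: "a < b" using img_less_cancel[OF assms] a b by (meson order_less_trans)
  define n where "n = (LEAST n. t < P (a + int n))"
  have ex: "t < P (a + int (nat (b - a)))" using b ab by simp
  then have n: "t < P (a + int n)" unfolding n_def by (rule LeastI)
  have "n \<noteq> 0"
  proof
    assume "n = 0" with n a show False by simp
  qed
  then have "\<not> t < P (a + int (n - 1))" 
    using not_less_Least[of "n - 1" "\<lambda>n. t < P (a + int n)"] unfolding n_def[symmetric] by simp
  with n \<open>n \<noteq> 0\<close> show ?thesis
    by (intro that[of "a + int (n - 1)"]) (auto simp: of_nat_diff algebra_simps)
qed

lemma img_block_unique:
  assumes "img f x P y" "P i \<le> t" "t < P (i + 1)" "P j \<le> t" "t < P (j + 1)"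
  shows "i = j"
  using img_less_cancel[OF assms(1), of i "j + 1"] img_less_cancel[OF assms(1), of j "i + 1"] assms
  by linarith

lemma img_shift_source:
  assumes "img f x P y"
  shows "img f (\<lambda>i. x (i + d)) (\<lambda>i. P (i + d)) y"
proof -
  have "\<exists>i. m < P (i + d)" "\<exists>i. P (i + d) < m" for m
    using assms unfolding img_def by (metis diff_add_cancel)+
  moreover have "P (i + d) \<le> P (i + 1 + d)" "seg y (P (i + d)) (P (i + 1 + d)) = f [x (i + d)]" for i
    using img_le_step[OF assms, of "i + d"] img_block[OF assms, of "i + d"]
    by (simp_all add: algebra_simps)
  ultimately show ?thesis by (simp add: img_def)
qed

lemma img_shift_target:
  assumes "img f x P y"
  shows "img f x (\<lambda>i. P i - c) (\<lambda>i. y (i + c))"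
proof -
  have "\<exists>i. m < P i - c" "\<exists>i. P i - c < m" for m
    using assms unfolding img_def by (metis less_diff_eq, metis diff_less_eq)
  then show ?thesis using assms by (simp add: img_def seg_shift)
qed

text \<open>A window of the source determines the word between its cuts, but not where this word
  lies. Cuts and letters are therefore compared relative to the left end of the window.\<close>

lemma img_local:
  assumes "img f x P y" "img f x' P' y'" "word_morphism f"
    and "\<And>i. a \<le> i \<Longrightarrow> i < b \<Longrightarrow> x' (i + d) = x i" "a \<le> b"
  shows "P' (b + d) - P' (a + d) = P b - P a"
    and "\<And>t. P a \<le> t \<Longrightarrow> t < P b \<Longrightarrow> y' (t + (P' (a + d) - P a)) = y t"
proof -
  have e: "seg x' (a + d) (b + d) = seg x a b"
    by (rule sym, rule seg_eqI) (use assms(4) in auto)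
  show 1: "P' (b + d) - P' (a + d) = P b - P a"
    using img_diff[OF assms(1,3,5)] img_diff[OF assms(2,3), of "a + d" "b + d"] assms(5) e by simp
  have 2: "seg y (P a) (P b) = seg y' (P' (a + d)) (P' (b + d))"
    using img_seg[OF assms(1,3,5)] img_seg[OF assms(2,3), of "a + d" "b + d"] assms(5) e by simp
  show "y' (t + (P' (a + d) - P a)) = y t" if "P a \<le> t" "t < P b" for t
    using seg_eqD[OF 2 that] by simp
qed

text \<open>The translation is read off at index 0; the local comparison carries it in both
  directions, and every position lies in some block.\<close>

lemma img_unique:
  assumes "img f x P y" "img f x' P' y'" "word_morphism f" "\<And>i. x' (i + d) = x i"
  obtains c where "\<And>i. P' (i + d) = P i + c" "\<And>t. y' (t + c) = y t"
proof -
  define c where "c = P' d - P 0"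
  have P: "P' (i + d) = P i + c" for i
    using img_local(1)[OF assms(1-3) assms(4), of 0 i] img_local(1)[OF assms(1-3) assms(4), of i 0]
    unfolding c_def by (cases "0 \<le> i") simp_all
  have "y' (t + c) = y t" for t
  proof -
    obtain j where j: "P j \<le> t" "t < P (j + 1)" by (rule img_blockE[OF assms(1)])
    show ?thesis
      using img_local(2)[OF assms(1-3) assms(4) _ j] P[of j] by simp
  qed
  with P show ?thesis by (rule that)
qed

lemma img_comp:
  assumes "img f x P y" "img h y Q z" "word_morphism h"
  shows "img (h \<circ> f) x (\<lambda>i. Q (P i)) z"
  unfolding img_def
proof (intro conjI allI)
  fix i
  show "Q (P i) \<le> Q (P (i + 1))"
    by (rule img_mono[OF assms(2) img_le_step[OF assms(1)]])
  show "seg z (Q (P i)) (Q (P (i + 1))) = (h \<circ> f) [x i]"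
    using img_seg[OF assms(2,3) img_le_step[OF assms(1), of i]] img_block[OF assms(1), of i] by simp
next
  fix m
  obtain j where "m < Q j" using assms(2) unfolding img_def by blast
  moreover obtain i where "j < P i" using assms(1) unfolding img_def by blast
  ultimately show "\<exists>i. m < Q (P i)"
    using img_mono[OF assms(2), of j "P i"] by (intro exI[of _ i]) linarith
next
  fix m
  obtain j where "Q j < m" using assms(2) unfolding img_def by blast
  moreover obtain i where "P i < j" using assms(1) unfolding img_def by blast
  ultimately show "\<exists>i. Q (P i) < m"
    using img_mono[OF assms(2), of "P i" j] by (intro exI[of _ i]) linarith
qed

text \<open>The cuts are partial sums of block lengths, counted negatively to the left of 0. Letters
  that are not erased, arbitrarily far on both sides, make these sums unbounded in both
  directions.\<close>

lemma img_exists: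
  assumes up: "\<And>m. \<exists>i\<ge>m. f [x i] \<noteq> []" and down: "\<And>m. \<exists>i\<le>m. f [x i] \<noteq> []"
  obtains P y where "img f x P y" "P 0 = p"
proof -
  let ?l = "\<lambda>i. int (length (f [x i]))"
  define P where "P i = p + (if 0 \<le> i then (\<Sum>k\<in>{0..<i}. ?l k) else - (\<Sum>k\<in>{i..<0}. ?l k))" for i
  have step: "P (i + 1) = P i + ?l i" for i
  proof (cases "0 \<le> i")
    case True
    then have "{0..<i + 1} = insert i {0..<i}" by auto
    then show ?thesis using True by (simp add: P_def)
  next
    case False
    then have "{i..<0} = insert i {i + 1..<0}" by auto
    then show ?thesis using False by (auto simp: P_def)
  qed
  have mono: "P i \<le> P j" if "i \<le> j" for i j
    using that by (induction j rule: int_ge_induct) (auto simp: step intro: order_trans)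
  have inc: "P i < P (i + 1)" if "f [x i] \<noteq> []" for i using that by (simp add: step)
  have up': "\<exists>i. m + int n < P i" if "\<exists>i. m < P i" for m n
  proof (induction n)
    case (Suc n)
    then obtain i where i: "m + int n < P i" by blast
    obtain j where "i \<le> j" "f [x j] \<noteq> []" using up by blast
    then have "P i < P (j + 1)" using mono[of i j] inc[of j] by linarith
    then show ?case using i by (intro exI[of _ "j + 1"]) simp
  qed (use that in simp)
  have upP: "\<exists>i. m < P i" for m
  proof -
    have "\<exists>i. P 0 - 1 < P i" by (rule exI[of _ 0]) simp
    from up'[OF this, of "nat (m - P 0 + 1)"] obtain i where "P 0 - 1 + int (nat (m - P 0 + 1)) < P i" ..
    then show ?thesis by (intro exI[of _ i]) linarith
  qed
  have down': "\<exists>i. P i < m - int n" if "\<exists>i. P i < m" for m n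
  proof (induction n)
    case (Suc n)
    then obtain i where i: "P i < m - int n" by blast
    obtain j where "j \<le> i - 1" "f [x j] \<noteq> []" using down by blast
    then have "P j < P i" using mono[of "j + 1" i] inc[of j] by linarith
    then show ?case using i by (intro exI[of _ "j"]) simp
  qed (use that in simp)
  have downP: "\<exists>i. P i < m" for m
  proof -
    have "\<exists>i. P i < P 0 + 1" by (rule exI[of _ 0]) simp
    from down'[OF this, of "nat (P 0 + 1 - m)"] obtain i where "P i < P 0 + 1 - int (nat (P 0 + 1 - m))" ..
    then show ?thesis by (intro exI[of _ i]) linarith
  qed
  \<comment> \<open>The letter at \<open>t\<close> is read from the block containing
    \<open>t\<close>; monotonicity of the cuts makes this block unique, so the choice is
    harmless.\<close>
  define y where "y t = (let j = (SOME j. P j \<le> t \<and> t < P (j + 1)) in f [x j] ! nat (t - P j))" for t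
  have blk: "(SOME j. P j \<le> t \<and> t < P (j + 1)) = i" if "P i \<le> t" "t < P (i + 1)" for i t
  proof (rule some_equality)
    fix j assume "P j \<le> t \<and> t < P (j + 1)"
    then show "j = i" using that mono[of "j + 1" i] mono[of "i + 1" j] by linarith
  qed (use that in simp)
  have y: "y (P i + int n) = f [x i] ! n" if "n < length (f [x i])" for i n
    unfolding y_def using blk[of i "P i + int n"] that by (simp only: step Let_def) simp
  have "seg y (P i) (P (i + 1)) = f [x i]" for i
    by (rule nth_equalityI) (auto simp: step nth_seg y)
  then have "img f x P y" using upP downP by (simp add: img_def step)
  moreover have "P 0 = p" by (simp add: P_def)
  ultimately show ?thesis by (rule that)
qed

text \<open>Diagonal argument: at stage \<open>k\<close>, infinitely many members agree on the
  window \<open>D k\<close>, by the pigeonhole principle, and the stages extend each other. Picking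
  \<open>r k\<close> from stage \<open>k\<close> gives convergence with an explicit rate, namely
  agreement on the window of radius \<open>N\<close> from index \<open>N\<close> on.\<close>

lemma compact_seq:
  fixes f :: "nat \<Rightarrow> int \<Rightarrow> 'c::finite"
  obtains r l where "strict_mono (r :: nat \<Rightarrow> nat)"
    "\<And>N n i. N \<le> n \<Longrightarrow> \<bar>i\<bar> \<le> int N \<Longrightarrow> f (r n) i = l i"
proof -
  define D where "D k = {- int k..int k}" for k :: nat
  let ?ag = "\<lambda>h k. {n. \<forall>i\<in>D k. f n i = h i}"
  have step: "\<exists>h'. infinite (?ag h' k) \<and> (\<forall>i\<in>D j. h' i = h i)"
    if inf: "infinite (?ag h j)" for h j k
  proof -
    have "finite (range (\<lambda>n. restrict (f n) (D k)))"
    proof (rule finite_subset)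
      show "range (\<lambda>n. restrict (f n) (D k)) \<subseteq> (\<Pi>\<^sub>E i\<in>D k. UNIV)" by auto
      show "finite (\<Pi>\<^sub>E i\<in>D k. UNIV :: 'c set)" by (rule finite_PiE) (auto simp: D_def)
    qed
    then have fin: "finite ((\<lambda>n. restrict (f n) (D k)) ` ?ag h j)"
      by (rule finite_subset[rotated]) auto
    obtain n0 where n0: "n0 \<in> ?ag h j"
      and inf': "infinite {n \<in> ?ag h j. restrict (f n) (D k) = restrict (f n0) (D k)}"
      using pigeonhole_infinite[OF inf fin] by auto
    have "{n \<in> ?ag h j. restrict (f n) (D k) = restrict (f n0) (D k)} \<subseteq> ?ag (f n0) k"
    proof
      fix n assume "n \<in> {n \<in> ?ag h j. restrict (f n) (D k) = restrict (f n0) (D k)}"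
      then have e: "restrict (f n) (D k) = restrict (f n0) (D k)" by simp
      have "f n i = f n0 i" if "i \<in> D k" for i
        using fun_cong[OF e, of i] that by simp
      then show "n \<in> ?ag (f n0) k" by simp
    qed
    then have "infinite (?ag (f n0) k)" using inf' finite_subset by blast
    then show ?thesis using n0 by auto
  qed
  have "\<exists>h. \<forall>k. infinite (?ag (h k) k) \<and> (\<forall>i\<in>D k. h (Suc k) i = h k i)"
  proof (rule dependent_nat_choice)
    obtain h' where "infinite (?ag h' 0)"
    proof -
      have "finite (range (\<lambda>n. f n 0))" by simp
      then obtain n0 where "infinite {n \<in> UNIV. f n 0 = f n0 0}"
        using pigeonhole_infinite[of "UNIV :: nat set" "\<lambda>n. f n 0"] by auto
      then show thesis using that[of "f n0"] by (simp add: D_def)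
    qed
    then show "\<exists>h. infinite (?ag h 0)" by blast
  qed (rule step)
  then obtain h where h: "\<And>k. infinite (?ag (h k) k)" "\<And>k i. i \<in> D k \<Longrightarrow> h (Suc k) i = h k i"
    by blast
  have hk: "h n i = h N i" if "N \<le> n" "i \<in> D N" for n N i
    using that(1)
  proof (induction n rule: dec_induct)
    case (step n)
    have "i \<in> D n" using that(2) step.hyps by (auto simp: D_def)
    then show ?case using h(2) step.IH by simp
  qed simp
  define l where "l i = h (nat \<bar>i\<bar>) i" for i
  have hl: "h n i = l i" if "i \<in> D n" for n i
    unfolding l_def by (rule hk) (use that in \<open>auto simp: D_def\<close>)
  have "\<exists>r. \<forall>k. r k \<in> ?ag (h k) k \<and> r k < r (Suc k)"
  proof (rule dependent_nat_choice)
    show "\<exists>n. n \<in> ?ag (h 0) 0" using h(1)[of 0] not_finite_existsD by auto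
    show "\<exists>n. n \<in> ?ag (h (Suc k)) (Suc k) \<and> m < n" for m k
      using h(1)[of "Suc k"] unfolding infinite_nat_iff_unbounded by blast
  qed
  then obtain r where r: "\<And>k. r k \<in> ?ag (h k) k" "\<And>k. r k < r (Suc k)" by blast
  show ?thesis
  proof
    show "strict_mono r" using r(2) by (simp add: strict_mono_Suc_iff)
    show "f (r n) i = l i" if "N \<le> n" "\<bar>i\<bar> \<le> int N" for N n i
    proof -
      have "i \<in> D n" using that by (auto simp: D_def)
      then show ?thesis using r(1)[of n] hl[of i n] by auto
    qed
  qed
qed

section \<open>Minimal morphism shifts\<close>

lemma seq_shift_funpow: "(seq_shift ^^ n) (x :: int \<Rightarrow> 'a) = (\<lambda>i. x (i + int n))"
  by (induction n) (simp_all add: seq_shift_def fun_eq_iff algebra_simps)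

lemma seq_shift_funpow_nat: "(seq_shift ^^ n) (x :: nat \<Rightarrow> 'a) = (\<lambda>i. x (i + n))"
  by (induction n) (simp_all add: seq_shift_def fun_eq_iff)

lemma morphism_language_sublist:
  "sublist u w \<Longrightarrow> w \<in> morphism_language \<sigma> \<Longrightarrow> u \<in> morphism_language \<sigma>"
  unfolding morphism_language_def using sublist_order.order_trans by blast

lemma morphism_language_image:
  assumes "word_morphism \<sigma>" "w \<in> morphism_language \<sigma>"
  shows "\<sigma> w \<in> morphism_language \<sigma>"
proof -
  obtain n a where "sublist w ((\<sigma> ^^ n) [a])"
    using assms(2) by (auto simp: morphism_language_def)
  then have "sublist (\<sigma> w) ((\<sigma> ^^ Suc n) [a])"
    using word_morphism_sublist[OF assms(1)] by simp
  then show ?thesis unfolding morphism_language_def by blast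
qed

lemma map_upt_eq_seg: "map (\<lambda>j. x (i + int j)) [0..<n] = seg x i (i + int n)"
  by (rule nth_equalityI) (auto simp: nth_seg)

lemma mem_morphism_shift:
  "x \<in> morphism_shift \<sigma> \<longleftrightarrow> (\<forall>a b. seg x a b \<in> morphism_language \<sigma>)"
proof
  assume x: "x \<in> morphism_shift \<sigma>"
  have "seg x a b \<in> morphism_language \<sigma>" for a b
  proof -
    have "seg x a (a + int (nat (b - a))) \<in> morphism_language \<sigma>"
      using x unfolding morphism_shift_def map_upt_eq_seg by blast
    then show ?thesis by (cases "a \<le> b") simp_all
  qed
  then show "\<forall>a b. seg x a b \<in> morphism_language \<sigma>" by blast
qed (simp add: morphism_shift_def map_upt_eq_seg)

text \<open>The points agreeing with \<open>x\<close> on a central window form a basic open set,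
  since only finitely many coordinates are constrained.\<close>

lemma closedin_fullshiftI:
  assumes "\<And>x. x \<notin> Y \<Longrightarrow> \<exists>N. \<forall>y. (\<forall>i. \<bar>i\<bar> \<le> int N \<longrightarrow> y i = x i) \<longrightarrow> y \<notin> Y"
  shows "closedin fullshift_topology Y"
proof -
  let ?T = "fullshift_topology :: (int \<Rightarrow> 'a) topology"
  have top: "topspace ?T = UNIV"
    by (simp add: fullshift_topology_def)
  have "openin ?T (- Y)"
    unfolding openin_subopen[of _ "- Y"]
  proof
    fix x assume "x \<in> - Y"
    then obtain N where N: "\<And>y. (\<And>i. \<bar>i\<bar> \<le> int N \<Longrightarrow> y i = x i) \<Longrightarrow> y \<notin> Y"
      using assms[of x] by blast
    define U where "U = (\<Pi>\<^sub>E k\<in>UNIV. if k \<in> {- int N..int N} then {x k} else UNIV)"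
    have "openin ?T U"
      unfolding U_def fullshift_topology_def
      by (rule product_topology_basis) (auto intro: finite_subset[of _ "{- int N..int N}"])
    moreover have "x \<in> U" by (auto simp: U_def)
    moreover have "U \<subseteq> - Y"
    proof
      fix y assume y: "y \<in> U"
      have "y i = x i" if "\<bar>i\<bar> \<le> int N" for i
      proof -
        have "y i \<in> (if i \<in> {- int N..int N} then {x i} else UNIV)"
          using y by (simp add: U_def PiE_iff)
        then show ?thesis using that by (simp add: abs_le_iff split: if_splits)
      qed
      then show "y \<in> - Y" using N by auto
    qed
    ultimately show "\<exists>U. openin ?T U \<and> x \<in> U \<and> U \<subseteq> - Y" by blast
  qed
  then show ?thesis by (simp add: closedin_def top Compl_eq_Diff_UNIV)
qed

text \<open>The assumption \<open>nonerasing\<close> asks only that some letter occurring in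
  \<open>X\<close> is not erased. Together with minimality, such letters then appear with bounded
  gaps in every point.\<close>

locale minimal_morphism =
  fixes \<sigma> :: "'a::finite list \<Rightarrow> 'a list" and X
  defines "X \<equiv> morphism_shift \<sigma>"
  assumes morph: "word_morphism \<sigma>"
    and min: "minimal_shift X"
    and aper: "aperiodic_shift X"
    and nonerasing: "\<exists>x\<in>X. \<exists>i. \<sigma> [x i] \<noteq> []"
begin

lemma X_seg: "x \<in> X \<Longrightarrow> seg x a b \<in> morphism_language \<sigma>"
  by (simp add: X_def mem_morphism_shift)

lemma X_I:
  assumes "\<And>a b. a \<le> b \<Longrightarrow> \<exists>x\<in>X. \<exists>a' b'. sublist (seg y a b) (seg x a' b')"
  shows "y \<in> X"
  unfolding X_def mem_morphism_shift
proof (intro allI)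
  fix a b
  obtain x a' b' where "x \<in> X" "sublist (seg y a (max a b)) (seg x a' b')"
    using assms[of a "max a b"] by auto
  moreover have "seg y a (max a b) = seg y a b" by (cases "a \<le> b") simp_all
  ultimately show "seg y a b \<in> morphism_language \<sigma>"
    using morphism_language_sublist X_seg by metis
qed

lemma X_shift: "x \<in> X \<Longrightarrow> (\<lambda>i. x (i + d)) \<in> X"
  by (simp add: X_def mem_morphism_shift seg_shift)

lemma X_nonempty: "X \<noteq> {}"
  using min by (simp add: minimal_shift_def)

lemma X_limit:
  assumes "\<And>N. \<exists>x\<in>X. \<forall>i. \<bar>i\<bar> \<le> int N \<longrightarrow> x i = y i"
  shows "y \<in> X"
proof (rule X_I)
  fix a b :: int assume "a \<le> b"
  obtain x where x: "x \<in> X" "\<And>i. \<bar>i\<bar> \<le> int (nat (max \<bar>a\<bar> \<bar>b\<bar>)) \<Longrightarrow> x i = y i"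
    using assms by blast
  have "seg y a b = seg x a b"
  proof (rule seg_eqI)
    fix i assume "a \<le> i" "i < b"
    then have "x i = y i" by (intro x(2)) linarith
    then show "y i = x (i + (a - a))" by simp
  qed simp
  then show "\<exists>x\<in>X. \<exists>a' b'. sublist (seg y a b) (seg x a' b')" using x(1) by auto
qed

section \<open>Aperiodicity and recurrence\<close>

lemma aperiodic:
  assumes "x \<in> X" "\<And>i. x (i + d) = x i"
  shows "d = 0"
proof (rule ccontr)
  assume "d \<noteq> 0"
  define n where "n = nat \<bar>d\<bar>"
  have "x (i + int n) = x i" for i
  proof (cases "0 \<le> d")
    case False
    then show ?thesis using assms(2)[of "i - d"] by (simp add: n_def)
  qed (simp add: n_def assms(2))
  then have "periodic_seq x"
    unfolding periodic_seq_def seq_shift_funpow using \<open>d \<noteq> 0\<close>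
    by (intro exI[of _ n]) (simp add: n_def)
  then show False using aper assms(1) by (simp add: aperiodic_shift_def)
qed

text \<open>The points of \<open>X\<close> in which the word never starts at a nonnegative position
  form a closed set \<open>Y\<close> that the shift maps into itself. A translate of
  \<open>z\<close> lies outside \<open>Y\<close>, so minimality leaves only
  \<open>Y = {}\<close>.\<close>

lemma recurrence:
  assumes x: "x \<in> X" and z: "z \<in> X" and ab: "a \<le> b"
  shows "\<exists>c\<ge>0. seg x c (c + (b - a)) = seg z a b"
proof -
  define Y where "Y = {x \<in> X. \<forall>c\<ge>0. seg x c (c + (b - a)) \<noteq> seg z a b}"
  have "closedin fullshift_topology Y"
  proof (rule closedin_fullshiftI)
    fix x assume "x \<notin> Y"
    then consider "x \<notin> X" | c where "c \<ge> 0" "seg x c (c + (b - a)) = seg z a b"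
      by (auto simp: Y_def)
    then show "\<exists>N. \<forall>y. (\<forall>i. \<bar>i\<bar> \<le> int N \<longrightarrow> y i = x i) \<longrightarrow> y \<notin> Y"
    proof cases
      case 1
      then obtain N where "\<not> (\<exists>y\<in>X. \<forall>i. \<bar>i\<bar> \<le> int N \<longrightarrow> y i = x i)"
        using X_limit[of x] by blast
      then show ?thesis by (intro exI[of _ N]) (auto simp: Y_def)
    next
      case 2
      have "seg y c (c + (b - a)) = seg z a b"
        if "\<forall>i. \<bar>i\<bar> \<le> int (nat (c + (b - a))) \<longrightarrow> y i = x i" for y
      proof -
        have "seg y c (c + (b - a)) = seg x c (c + (b - a))"
          by (rule seg_eqI) (use that 2(1) ab in auto)
        then show ?thesis using 2 by simp
      qed
      then show ?thesis using 2(1) by (intro exI[of _ "nat (c + (b - a))"]) (auto simp: Y_def)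
    qed
  qed
  moreover have "seq_shift ` Y \<subseteq> Y"
  proof
    fix y assume "y \<in> seq_shift ` Y"
    then obtain x where x: "x \<in> Y" and y: "y = (\<lambda>i. x (i + 1))"
      by (auto simp: seq_shift_def fun_eq_iff)
    have "seg y c (c + (b - a)) \<noteq> seg z a b" if "c \<ge> 0" for c
    proof -
      have "seg x (c + 1) (c + 1 + (b - a)) \<noteq> seg z a b" using x that by (simp add: Y_def)
      then show ?thesis by (simp add: y seg_shift algebra_simps)
    qed
    moreover have "y \<in> X" using x X_shift by (simp add: Y_def y)
    ultimately show "y \<in> Y" by (simp add: Y_def)
  qed
  moreover have "(\<lambda>i. z (i + a)) \<in> X - Y"
  proof -
    have "seg (\<lambda>i. z (i + a)) 0 (0 + (b - a)) = seg z a b" by (simp add: seg_shift)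
    then show ?thesis using X_shift[OF z] unfolding Y_def by blast
  qed
  moreover have "Y \<subseteq> X" by (auto simp: Y_def)
  ultimately have "Y = {}"
    using min unfolding minimal_shift_def by blast
  then show ?thesis using x by (auto simp: Y_def)
qed

text \<open>Compactness: points avoiding the word on longer and longer windows would have a limit in
  \<open>X\<close>, and the word occurs in the limit by \<open>recurrence\<close>.\<close>

lemma uniform_recurrence:
  assumes z: "z \<in> X" and ab: "a \<le> b"
  shows "\<exists>g. \<forall>x\<in>X. \<forall>i. sublist (seg z a b) (seg x i (i + int g))"
proof (rule ccontr)
  assume neg: "\<not> ?thesis"
  have "\<exists>x\<in>X. \<not> sublist (seg z a b) (seg x 0 (int g))" for g
  proof -
    obtain x i where "x \<in> X" "\<not> sublist (seg z a b) (seg x i (i + int g))"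
      using neg by blast
    then show ?thesis
      by (intro bexI[of _ "\<lambda>j. x (j + i)"]) (auto simp: seg_shift X_shift add.commute)
  qed
  then obtain f where f: "\<And>g. f g \<in> X" "\<And>g. \<not> sublist (seg z a b) (seg (f g) 0 (int g))"
    by metis
  obtain r l where r: "strict_mono (r :: nat \<Rightarrow> nat)"
    and l: "\<And>N n i. N \<le> n \<Longrightarrow> \<bar>i\<bar> \<le> int N \<Longrightarrow> f (r n) i = l i"
    by (rule compact_seq[of f]) (rule that)
  have "l \<in> X"
    by (rule X_limit) (use l f(1) in blast)
  then obtain c where c: "c \<ge> 0" "seg l c (c + (b - a)) = seg z a b"
    using recurrence[OF _ z ab] by blast
  \<comment> \<open>The radius \<open>N\<close> reaches the end of the occurrence in the limit, and
    \<open>r N \<ge> N\<close> places that occurrence inside the window that should avoid the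
    word.\<close>
  define N where "N = nat (c + (b - a))"
  have "seg (f (r N)) c (c + (b - a)) = seg l c (c + (b - a))"
    by (rule seg_eqI) (use l[of N N] c(1) ab in \<open>auto simp: N_def\<close>)
  moreover have "c + (b - a) \<le> int (r N)"
    using seq_suble[OF r, of N] c(1) ab by (simp add: N_def)
  ultimately have "sublist (seg z a b) (seg (f (r N)) 0 (int (r N)))"
    using sublist_seg[of 0 c "c + (b - a)" "int (r N)" "f (r N)"] c ab by simp
  then show False using f(2) by blast
qed

text \<open>Only words occurring in points of \<open>X\<close> are counted; a word of
  \<open>morphism_language \<sigma>\<close> need not extend to a two-sided point.\<close>

definition words :: "nat \<Rightarrow> 'a list set" where
  "words n = {seg x a (a + int n) |x a. x \<in> X}"

lemma seg_in_words: "x \<in> X \<Longrightarrow> a \<le> b \<Longrightarrow> n = nat (b - a) \<Longrightarrow> seg x a b \<in> words n"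
  unfolding words_def by (rule CollectI, rule exI[of _ x], rule exI[of _ a]) simp

lemma length_words: "w \<in> words n \<Longrightarrow> length w = n"
  by (auto simp: words_def)

lemma finite_words: "finite (words n)"
  by (rule finite_subset[OF _ finite_lists_length_eq[of "UNIV :: 'a set" n]])
    (auto simp: length_words)

lemma all_words_recur:
  "\<exists>G. \<forall>x\<in>X. \<forall>i. \<forall>w\<in>words n. sublist w (seg x i (i + int G))"
proof -
  have "\<exists>g. \<forall>x\<in>X. \<forall>i. sublist w (seg x i (i + int g))" if "w \<in> words n" for w
    using that uniform_recurrence by (force simp: words_def)
  then obtain g where g: "\<And>w x i. w \<in> words n \<Longrightarrow> x \<in> X \<Longrightarrow> sublist w (seg x i (i + int (g w)))"
    by metis
  define G where "G = (\<Sum>w\<in>words n. g w)"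
  have "sublist w (seg x i (i + int G))" if "w \<in> words n" "x \<in> X" for w x i
  proof -
    have "g w \<le> G" unfolding G_def using finite_words that(1) by (simp add: member_le_sum)
    then have "sublist (seg x i (i + int (g w))) (seg x i (i + int G))"
      by (intro sublist_seg) auto
    with g[OF that] show ?thesis by (rule sublist_order.order_trans)
  qed
  then show ?thesis by blast
qed

definition letters :: "'a set" where
  "letters = {x i |x i. x \<in> X}"

lemma letters_I: "x \<in> X \<Longrightarrow> x i \<in> letters"
  by (auto simp: letters_def)

lemma letters_recur:
  obtains g where "\<And>x i b. x \<in> X \<Longrightarrow> b \<in> letters \<Longrightarrow> b \<in> set (seg x i (i + int g))"
proof -
  obtain g where g: "\<And>x i w. x \<in> X \<Longrightarrow> w \<in> words 1 \<Longrightarrow> sublist w (seg x i (i + int g))"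
    using all_words_recur by metis
  have "b \<in> set (seg x i (i + int g))" if x: "x \<in> X" and b: "b \<in> letters" for x i b
  proof -
    obtain z j where "z \<in> X" "b = z j" using b by (auto simp: letters_def)
    then have "[b] \<in> words 1" using seg_in_words[of z j "j + 1" 1] by simp
    then have "sublist [b] (seg x i (i + int g))" using g x by blast
    then show ?thesis using set_mono_sublist by fastforce
  qed
  then show ?thesis by (rule that)
qed

text \<open>A return bound fixed once for all points and letters. Among \<open>gap\<close>
  consecutive letters there is always one with the longest image under a given morphism, whatever
  the morphism is.\<close>

definition gap :: nat where
  "gap = (SOME g. \<forall>x\<in>X. \<forall>i. \<forall>b\<in>letters. b \<in> set (seg x i (i + int g)))"

lemma gap: "x \<in> X \<Longrightarrow> b \<in> letters \<Longrightarrow> b \<in> set (seg x i (i + int gap))"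
proof -
  have "\<exists>g. \<forall>x\<in>X. \<forall>i. \<forall>b\<in>letters. b \<in> set (seg x i (i + int g))"
    using letters_recur by metis
  from someI_ex[OF this] show "x \<in> X \<Longrightarrow> b \<in> letters \<Longrightarrow> b \<in> set (seg x i (i + int gap))"
    unfolding gap_def by blast
qed

section \<open>Images and preimages within the shift\<close>

lemma img_in_X:
  assumes "x \<in> X" "img \<sigma> x P y" shows "y \<in> X"
  unfolding X_def mem_morphism_shift
proof (intro allI)
  fix a b
  obtain i j where i: "P i < a" and j: "max a b < P j"
    using assms(2) unfolding img_def by meson
  then have "i \<le> j" using img_less_cancel[OF assms(2), of i j] by linarith
  have "sublist (seg y a (max a b)) (seg y (P i) (P j))"
    by (rule sublist_seg) (use i j in auto)
  moreover have "seg y (P i) (P j) \<in> morphism_language \<sigma>"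
    unfolding img_seg[OF assms(2) morph \<open>i \<le> j\<close>]
    by (rule morphism_language_image[OF morph X_seg[OF assms(1)]])
  moreover have "seg y a (max a b) = seg y a b" by (cases "a \<le> b") simp_all
  ultimately show "seg y a b \<in> morphism_language \<sigma>"
    using morphism_language_sublist by metis
qed

lemma nonerased_gap:
  assumes "x \<in> X" shows "\<exists>j\<ge>i. j < i + int gap \<and> \<sigma> [x j] \<noteq> []"
proof -
  obtain b where b: "b \<in> letters" "\<sigma> [b] \<noteq> []" using nonerasing by (auto simp: letters_def)
  then show ?thesis using gap[OF assms b(1), of i] by (auto simp: seg_def)
qed

lemma image_exists:
  assumes "x \<in> X"
  obtains P y where "img \<sigma> x P y" "P 0 = p" "y \<in> X"
proof -
  obtain P y where "img \<sigma> x P y" "P 0 = p"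
  proof (rule img_exists[of \<sigma> x p])
    show "\<exists>i\<ge>m. \<sigma> [x i] \<noteq> []" for m using nonerased_gap[OF assms, of m] by blast
    show "\<exists>i\<le>m. \<sigma> [x i] \<noteq> []" for m using nonerased_gap[OF assms, of "m - int gap"]
      by (metis diff_add_cancel less_imp_le)
  qed (rule that)
  with img_in_X[OF assms] that show ?thesis by blast
qed

text \<open>Block 0 contains position 0, so the cut \<open>Ps n 0\<close> takes finitely many values
  and is constant along a subsequence. Convergence of the sources then forces convergence of all
  cuts and of the images.\<close>

lemma image_limit:
  assumes X: "\<And>n. xs n \<in> X" and I: "\<And>n. img \<sigma> (xs n) (Ps n) (ys n)"
    and P0: "\<And>n. Ps n 0 \<le> 0" and P1: "\<And>n. 0 < Ps n 1"
  obtains r x P y where "strict_mono (r :: nat \<Rightarrow> nat)" "x \<in> X" "img \<sigma> x P y" "P 0 \<le> 0" "0 < P 1"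
    "\<And>N. \<exists>K. \<forall>n\<ge>K. \<forall>i. \<bar>i\<bar> \<le> int N \<longrightarrow> xs (r n) i = x i \<and> Ps (r n) i = P i \<and> ys (r n) i = y i"
proof -
  define M where "M = Max (range (\<lambda>a. int (length (\<sigma> [a]))))"
  have M: "int (length (\<sigma> [a])) \<le> M" for a
    unfolding M_def by (rule Max_ge) auto
  have "Ps n 0 \<in> {- M..0}" for n
    using P0[of n] P1[of n] img_step[OF I, of n 0] M[of "xs n 0"] by simp
  then have fin: "finite (range (\<lambda>n. Ps n 0))"
    by (intro finite_subset[of "range (\<lambda>n. Ps n 0)" "{- M..0}"] image_subsetI) auto
  obtain n0 where "infinite {n \<in> UNIV. Ps n 0 = Ps n0 0}"
    using pigeonhole_infinite[OF infinite_UNIV_nat fin] by blast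
  then have inf: "infinite {n. Ps n 0 = Ps n0 0}" by simp
  define p where "p = Ps n0 0"
  define r1 where "r1 = enumerate {n. Ps n 0 = Ps n0 0}"
  have r1: "strict_mono r1" "\<And>n. Ps (r1 n) 0 = p"
    using strict_mono_enumerate[OF inf] enumerate_in_set[OF inf] by (auto simp: r1_def p_def)
  obtain r2 x where r2: "strict_mono (r2 :: nat \<Rightarrow> nat)"
    and x: "\<And>N n i. N \<le> n \<Longrightarrow> \<bar>i\<bar> \<le> int N \<Longrightarrow> xs (r1 (r2 n)) i = x i"
    by (rule compact_seq[of "\<lambda>n. xs (r1 n)"]) (rule that)
  define r where "r n = r1 (r2 n)" for n
  have r: "strict_mono r" using r1(1) r2 by (simp add: r_def strict_mono_def)
  note x = x[folded r_def]
  have r0: "Ps (r n) 0 = p" for n using r1(2) by (simp add: r_def)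
  have xX: "x \<in> X" by (rule X_limit) (use x X in blast)
  obtain P y where P: "img \<sigma> x P y" "P 0 = p" by (rule image_exists[OF xX])
  have PsP: "Ps (r n) i = P i" if "N \<le> n" "\<bar>i\<bar> \<le> int N" for N n i
  proof -
    have e: "xs (r n) (j + 0) = x j" if "- int N \<le> j" "j < int N" for j
      using x[of N n j] that \<open>N \<le> n\<close> by simp
    have "Ps (r n) i - Ps (r n) (- int N) = P i - P (- int N)" if "\<bar>i\<bar> \<le> int N" for i
      using img_local(1)[OF P(1) I morph, of "- int N" i "r n" 0] e that by simp
    from this[of i] this[of 0] that show ?thesis by (simp add: r0 P(2))
  qed
  show ?thesis
  proof (rule that[OF r xX P(1)])
    show "P 0 \<le> 0" "0 < P 1"
      using PsP[of 1 1 0] PsP[of 1 1 1] P0[of "r 1"] P1[of "r 1"] by auto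
    fix N
    obtain i where "P i < - int N" using P(1) unfolding img_def by blast
    obtain j where "int N < P j" using P(1) unfolding img_def by blast
    \<comment> \<open>Source windows of radius \<open>K\<close> have images covering
      \<open>[-N, N]\<close>; because letters may be erased, \<open>K\<close> can be larger than
      \<open>N\<close>.\<close>
    define K where "K = max N (nat (max \<bar>i\<bar> \<bar>j\<bar>))"
    have K: "P (- int K) < - int N" "int N < P (int K)"
    proof -
      have "P (- int K) \<le> P i" "P j \<le> P (int K)"
        by (rule img_mono[OF P(1)]; simp add: K_def)+
      then show "P (- int K) < - int N" "int N < P (int K)"
        using \<open>P i < - int N\<close> \<open>int N < P j\<close> by auto
    qed
    have "ys (r n) t = y t" if "K \<le> n" "\<bar>t\<bar> \<le> int N" for n t
    proof -
      have e: "xs (r n) (j + 0) = x j" if "- int K \<le> j" "j < int K" for j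
        using x[of K n j] that \<open>K \<le> n\<close> by simp
      show ?thesis
        using img_local(2)[OF P(1) I morph, of "- int K" "int K" "r n" 0 t] e K that PsP[of K n "- int K"] by simp
    qed
    moreover have "N \<le> K" by (simp add: K_def)
    ultimately show "\<exists>K. \<forall>n\<ge>K. \<forall>i. \<bar>i\<bar> \<le> int N \<longrightarrow>
        xs (r n) i = x i \<and> Ps (r n) i = P i \<and> ys (r n) i = y i"
      using x PsP by (intro exI[of _ K]) (meson order_trans)
  qed
qed

text \<open>All central windows of \<open>y\<close> occur in a single image \<open>y0\<close>, by
  recurrence. The factorization of \<open>y0\<close>, recentred at these occurrences, has a limit,
  and its image is \<open>y\<close>.\<close>

lemma preimage_exists:
  assumes y: "y \<in> X"
  obtains x P where "x \<in> X" "img \<sigma> x P y"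
proof -
  obtain x0 where x0: "x0 \<in> X" using X_nonempty by blast
  obtain P0 y0 where I0: "img \<sigma> x0 P0 y0" "y0 \<in> X" by (rule image_exists[OF x0])
  have "\<exists>c. seg y0 c (c + (int n - - int n)) = seg y (- int n) (int n)" for n
    using recurrence[OF I0(2) y, of "- int n" "int n"] by auto
  then obtain c where c: "\<And>n. seg y0 (c n) (c n + (int n - - int n)) = seg y (- int n) (int n)"
    by metis
  have "\<exists>j. P0 j \<le> c n + int n \<and> c n + int n < P0 (j + 1)" for n
    using img_blockE[OF I0(1), of "c n + int n"] by blast
  then obtain j where j: "\<And>n. P0 (j n) \<le> c n + int n" "\<And>n. c n + int n < P0 (j n + 1)"
    by metis
  \<comment> \<open>Position \<open>c n + int n\<close> is the middle of the occurrence and becomes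
    the origin; \<open>j n\<close> is the block containing it.\<close>
  define xs where "xs n i = x0 (i + j n)" for n i
  define Ps where "Ps n i = P0 (i + j n) - (c n + int n)" for n i
  define ys where "ys n t = y0 (t + (c n + int n))" for n t
  have ys: "ys n t = y t" if "- int n \<le> t" "t < int n" for n t
    using seg_eqD[OF c[of n], of "t + (c n + int n)"] that by (simp add: ys_def)
  obtain r x P y' where r: "strict_mono (r :: nat \<Rightarrow> nat)" and x: "x \<in> X" "img \<sigma> x P y'"
    and lim: "\<And>N. \<exists>K. \<forall>n\<ge>K. \<forall>i. \<bar>i\<bar> \<le> int N \<longrightarrow>
      xs (r n) i = x i \<and> Ps (r n) i = P i \<and> ys (r n) i = y' i"
  proof (rule image_limit[of xs Ps ys])
    show "xs n \<in> X" for n unfolding xs_def by (rule X_shift[OF x0])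
    show "img \<sigma> (xs n) (Ps n) (ys n)" for n
      unfolding xs_def Ps_def ys_def by (rule img_shift_target[OF img_shift_source[OF I0(1)]])
    show "Ps n 0 \<le> 0" "0 < Ps n 1" for n
      using j[of n] by (simp_all add: Ps_def add.commute)
  qed (rule that)
  have "y' t = y t" for t
  proof -
    obtain K where K: "\<And>n. n \<ge> K \<Longrightarrow> ys (r n) t = y' t"
      using lim[of "nat \<bar>t\<bar>"] by auto
    define n where "n = max K (nat (\<bar>t\<bar> + 1))"
    have "n \<le> r n" by (rule seq_suble[OF r])
    moreover have "\<bar>t\<bar> < int n" by (simp add: n_def)
    ultimately have "ys (r n) t = y t" by (intro ys) linarith+
    then show ?thesis using K[of n] by (simp add: n_def)
  qed
  then have "y' = y" by blast
  with x that show ?thesis by blast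
qed

lemma image_pow_exists:
  assumes "x \<in> X"
  obtains P y where "img (\<sigma> ^^ n) x P y" "y \<in> X"
proof -
  have "\<exists>P y. img (\<sigma> ^^ n) x P y \<and> y \<in> X"
  proof (induction n)
    case 0
    have "img (\<sigma> ^^ 0) x (\<lambda>i. i) x"
      by (auto simp: img_def intro: lt_ex gt_ex)
    then show ?case using assms by blast
  next
    case (Suc n)
    then obtain P y where P: "img (\<sigma> ^^ n) x P y" "y \<in> X" by blast
    obtain Q z where "img \<sigma> y Q z" "z \<in> X" by (rule image_exists[OF P(2)])
    then show ?case using img_comp[OF P(1) _ morph] by (simp only: funpow.simps) blast
  qed
  with that show ?thesis by blast
qed

lemma preimage_pow_exists:
  assumes "y \<in> X"
  obtains x P where "x \<in> X" "img (\<sigma> ^^ n) x P y"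
proof -
  have "\<exists>x\<in>X. \<exists>P. img (\<sigma> ^^ n) x P y"
    using assms
  proof (induction n arbitrary: y)
    case 0
    have "img (\<sigma> ^^ 0) y (\<lambda>i. i) y"
      by (auto simp: img_def intro: lt_ex gt_ex)
    then show ?case using 0 by blast
  next
    case (Suc n)
    obtain z Q where z: "z \<in> X" "img \<sigma> z Q y" by (rule preimage_exists[OF Suc.prems])
    obtain x P where "x \<in> X" "img (\<sigma> ^^ n) x P z" using Suc.IH[OF z(1)] by blast
    then show ?case using img_comp[OF _ z(2) morph] by (simp only: funpow.simps) blast
  qed
  with that show ?thesis by blast
qed

end

section \<open>Two-sided recognizability\<close>

text \<open>Sliding the window by one position removes \<open>w ! q\<close> and adds
  \<open>w ! (q + p)\<close>, which is the same letter by periodicity.\<close>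

lemma period_mset_window:
  assumes per: "\<And>t. t + p < length w \<Longrightarrow> w ! t = w ! (t + p)"
    and "q + p \<le> length w"
  shows "mset (take p (drop q w)) = mset (take p w)"
  using assms(2)
proof (induction q)
  case (Suc q)
  have "drop q w = w ! q # drop (Suc q) w" using Suc.prems by (simp add: Cons_nth_drop_Suc)
  then have "take (Suc p) (drop q w) = w ! q # take p (drop (Suc q) w)" by simp
  moreover have "take (Suc p) (drop q w) = take p (drop q w) @ [w ! (q + p)]"
    using Suc.prems by (simp add: take_Suc_conv_app_nth)
  ultimately have "add_mset (w ! q) (mset (take p (drop (Suc q) w))) =
      add_mset (w ! (q + p)) (mset (take p (drop q w)))"
    by (metis mset.simps(2) mset_append union_mset_add_mset_right add.right_neutral mset.simps(1))
  then show ?case using per[of q] Suc by simp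
qed simp

definition block_index :: "(int \<Rightarrow> int) \<Rightarrow> int \<Rightarrow> int" where
  "block_index P t = (SOME j. P j \<le> t \<and> t < P (j + 1))"

lemma block_index:
  assumes "img f x P y"
  shows "P (block_index P t) \<le> t" "t < P (block_index P t + 1)"
proof -
  have "\<exists>j. P j \<le> t \<and> t < P (j + 1)" using img_blockE[OF assms, of t] by blast
  from someI_ex[OF this] show "P (block_index P t) \<le> t" "t < P (block_index P t + 1)"
    by (simp_all add: block_index_def)
qed

context minimal_morphism
begin

section \<open>Block lengths and the uniqueness of offsets\<close>

definition max_length :: "('a list \<Rightarrow> 'b list) \<Rightarrow> nat" where
  "max_length f = Max ((\<lambda>b. length (f [b])) ` letters)"

lemma letters_nonempty: "letters \<noteq> {}"
  using X_nonempty by (auto simp: letters_def)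

lemma length_le_max_length: "b \<in> letters \<Longrightarrow> length (f [b]) \<le> max_length f"
  unfolding max_length_def by (rule Max_ge) auto

lemma max_length_attained: obtains b where "b \<in> letters" "length (f [b]) = max_length f"
proof -
  have "max_length f \<in> (\<lambda>b. length (f [b])) ` letters"
    unfolding max_length_def by (rule Max_in) (use letters_nonempty in auto)
  then show ?thesis using that by auto
qed

text \<open>A window of this length contains all words of length \<open>gap + 1\<close> of
  \<open>X\<close>. This length is the one in \<open>short_word_in_image\<close>, and it does not
  depend on the level \<open>n\<close>.\<close>

definition rec_length :: nat where
  "rec_length = (SOME G. \<forall>x\<in>X. \<forall>i. \<forall>w\<in>words (gap + 1). sublist w (seg x i (i + int G)))"

lemma rec_length:
  "x \<in> X \<Longrightarrow> w \<in> words (gap + 1) \<Longrightarrow> sublist w (seg x i (i + int rec_length))"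
  using someI_ex[OF all_words_recur[of "gap + 1"]] unfolding rec_length_def by blast

lemma rec_length_pos: "0 < rec_length"
proof (rule ccontr)
  assume "\<not> 0 < rec_length"
  moreover obtain x where x: "x \<in> X" using X_nonempty by blast
  moreover have "seg x 0 (int gap + 1) \<in> words (gap + 1)" by (rule seg_in_words[OF x]) auto
  ultimately show False
    using rec_length[OF x, of "seg x 0 (int gap + 1)" 0] sublist_length_le
    by (metis add_0 le_zero_eq length_words list.size(3) not_gr_zero of_nat_0 seg_empty order_refl
        Suc_eq_plus1 nat.distinct(1))
qed

context
  fixes f :: "'a list \<Rightarrow> 'b list"
  assumes f: "word_morphism f"
begin

lemma img_step_le:
  assumes "v \<in> X" "img f v R y"
  shows "R (i + int n) \<le> R i + int (n * max_length f)"
proof (induction n)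
  case (Suc n)
  have "R (i + int n + 1) = R (i + int n) + int (length (f [v (i + int n)]))"
    by (rule img_step[OF assms(2)])
  moreover have "length (f [v (i + int n)]) \<le> max_length f"
    by (rule length_le_max_length[OF letters_I[OF assms(1)]])
  ultimately show ?case using Suc by (simp add: algebra_simps)
qed simp

text \<open>Each run of \<open>gap\<close> letters contains a letter with an image of length
  \<open>max_length f\<close>. So distances between cuts are comparable to
  \<open>max_length f\<close>, also when single letters are short or erased.\<close>

lemma img_step_ge:
  assumes "v \<in> X" "img f v R y"
  shows "R i + int (n * max_length f) \<le> R (i + int (gap * n))"
proof (induction n)
  case (Suc n)
  let ?j = "i + int (gap * n)"
  obtain b where b: "b \<in> letters" "length (f [b]) = max_length f" by (rule max_length_attained)
  have "R (?j + int gap) = R ?j + int (length (f (seg v ?j (?j + int gap))))"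
    by (rule img_diff[OF assms(2) f]) simp
  moreover have "max_length f \<le> length (f (seg v ?j (?j + int gap)))"
    using word_morphism_member_le[OF f gap[OF assms(1) b(1), of ?j]] b(2) by simp
  ultimately show ?case using Suc by (simp add: algebra_simps)
qed simp

end

text \<open>This many blocks cover at least \<open>(rec_length + 1) * max_length f\<close>
  positions: enough for \<open>rec_length\<close> blocks of the other factorization, and one further
  \<open>max_length f\<close> to absorb the offset.\<close>

definition context_length :: nat where "context_length = gap * (rec_length + 1)"

text \<open>After the block containing the first letter of \<open>z\<close>, the next
  \<open>gap\<close> blocks have total length at least \<open>max_length (\<sigma> ^^ n)\<close>, so
  \<open>gap + 1\<close> blocks cover \<open>z\<close>.\<close>

lemma short_word_in_image:
  assumes "z \<in> words p" "p \<le> max_length (\<sigma> ^^ n)"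
  shows "\<exists>u\<in>words (gap + 1). sublist z ((\<sigma> ^^ n) u)"
proof -
  let ?f = "\<sigma> ^^ n"
  have f: "word_morphism ?f" by (rule word_morphism_funpow[OF morph])
  obtain y a where y: "y \<in> X" and z: "z = seg y a (a + int p)"
    using assms(1) by (auto simp: words_def)
  obtain x P where x: "x \<in> X" "img ?f x P y" by (rule preimage_pow_exists[OF y])
  obtain i where i: "P i \<le> a" "a < P (i + 1)" by (rule img_blockE[OF x(2)])
  define b where "b = i + int (gap + 1)"
  have b: "a + int p \<le> P b" "i \<le> b"
    using img_step_ge[OF f x, of "i + 1" 1] i(2) assms(2) by (auto simp: b_def algebra_simps)
  have "sublist z (seg y (P i) (P b))"
    unfolding z by (rule sublist_seg) (use i b in auto)
  also have "seg y (P i) (P b) = ?f (seg x i b)" by (rule img_seg[OF x(2) f b(2)])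
  finally show ?thesis
    by (rule bexI) (rule seg_in_words[OF x(1) b(2)], simp add: b_def)
qed

text \<open>Two offsets give \<open>W\<close> the period \<open>p = e - d\<close>, so all its
  factors of length \<open>p\<close> have the same multiset of letters. Since \<open>p\<close> is at
  most \<open>max_length (\<sigma> ^^ n)\<close>, every word of length \<open>p\<close> of
  \<open>X\<close> is among them. Consecutive windows of length \<open>p\<close> in a point
  \<open>x\<close> differ only by losing \<open>x i\<close> and gaining \<open>x (i + p)\<close>,
  hence \<open>x\<close> has period \<open>p\<close>, against aperiodicity.\<close>

lemma offset_unique:
  assumes w: "\<And>u. u \<in> words (gap + 1) \<Longrightarrow> sublist u w"
    and de: "d < e" "e < max_length (\<sigma> ^^ n)"
    and len: "length ((\<sigma> ^^ n) w) + e \<le> length ((\<sigma> ^^ n) w')"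
    and d: "take (length ((\<sigma> ^^ n) w)) (drop d ((\<sigma> ^^ n) w')) = (\<sigma> ^^ n) w"
    and e: "take (length ((\<sigma> ^^ n) w)) (drop e ((\<sigma> ^^ n) w')) = (\<sigma> ^^ n) w"
  shows False
proof -
  let ?f = "\<sigma> ^^ n"
  have f: "word_morphism ?f" by (rule word_morphism_funpow[OF morph])
  define W where "W = ?f w"
  define p where "p = e - d"
  have per: "W ! t = W ! (t + p)" if t: "t + p < length W" for t
  proof -
    have "W ! t = take (length W) (drop e (?f w')) ! t" using e by (simp add: W_def)
    also have "\<dots> = ?f w' ! (e + t)" using t len by (simp add: W_def)
    also have "\<dots> = take (length W) (drop d (?f w')) ! (t + p)"
      using t len de(1) by (simp add: W_def p_def add.commute)
    also have "\<dots> = W ! (t + p)" using d by (simp add: W_def)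
    finally show ?thesis .
  qed
  have ms: "mset z = mset (take p W)" if zp: "z \<in> words p" for z
  proof -
    have "p \<le> max_length ?f" using de by (simp add: p_def)
    then obtain u where u: "u \<in> words (gap + 1)" "sublist z (?f u)"
      using short_word_in_image[OF zp] by blast
    note u(2)
    also have "sublist (?f u) W"
      unfolding W_def by (rule word_morphism_sublist[OF f w[OF u(1)]])
    finally obtain ps ss where W: "W = ps @ z @ ss" by (auto simp: sublist_def)
    have "length z = p" by (rule length_words[OF zp])
    then have "take p (drop (length ps) W) = z" "length ps + p \<le> length W" by (simp_all add: W)
    then show ?thesis using period_mset_window[of p W "length ps"] per by simp
  qed
  obtain x where x: "x \<in> X" using X_nonempty by blast
  have p: "0 < p" using de by (simp add: p_def)
  have "x (i + int p) = x i" for i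
  proof -
    have "seg x i (i + int p) = x i # seg x (i + 1) (i + int p)" by (rule seg_Cons) (use p in simp)
    moreover have "seg x (i + 1) (i + 1 + int p) = seg x (i + 1) (i + int p) @ [x (i + int p)]"
      using seg_append[of "i + 1" "i + int p" "i + 1 + int p" x] seg_single[of x "i + int p"] p
      by (simp add: algebra_simps)
    moreover have "mset (seg x i (i + int p)) = mset (seg x (i + 1) (i + 1 + int p))"
      using ms[of "seg x i (i + int p)"] ms[of "seg x (i + 1) (i + 1 + int p)"]
        seg_in_words[OF x] by simp
    ultimately show ?thesis by simp
  qed
  then show False using aperiodic[OF x, of "int p"] p by simp
qed

text \<open>Two factorizations of the same sequence into blocks are compared through the block of the
  second one that contains the start of the \<open>i\<close>-th block of the first one.\<close>

definition local_context ::
  "(int \<Rightarrow> 'a) \<Rightarrow> (int \<Rightarrow> 'a) \<Rightarrow> (int \<Rightarrow> int) \<Rightarrow> (int \<Rightarrow> int) \<Rightarrow> int \<Rightarrow> 'a list \<times> 'a list" where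
  "local_context v v' R R' i = (seg v i (i + int rec_length),
     seg v' (block_index R' (R i)) (block_index R' (R i) + int context_length))"

text \<open>Besides two consecutive contexts it records by how many blocks the second factorization
  advances, so that cuts can be followed from one index to the next. The advance is nonnegative, so
  \<open>nat\<close> loses nothing.\<close>

definition transition where
  "transition v v' R R' i = (local_context v v' R R' i,
     nat (block_index R' (R (i + 1)) - block_index R' (R i)), local_context v v' R R' (i + 1))"

definition factorizations ::
  "nat \<Rightarrow> (int \<Rightarrow> 'a) \<Rightarrow> (int \<Rightarrow> 'a) \<Rightarrow> (int \<Rightarrow> int) \<Rightarrow> (int \<Rightarrow> int) \<Rightarrow> (int \<Rightarrow> 'a) \<Rightarrow> bool" where
  "factorizations n v v' R R' y \<longleftrightarrow>
     v \<in> X \<and> v' \<in> X \<and> img (\<sigma> ^^ n) v R y \<and> img (\<sigma> ^^ n) v' R' y"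

text \<open>One block of the first factorization has length at most
  \<open>max_length (\<sigma> ^^ n)\<close>, and \<open>gap\<close> blocks of the second cover at
  least that much. The bound on the advance is therefore the same at all levels.\<close>

lemma block_index_step:
  assumes "factorizations n v v' R R' y"
  shows "block_index R' (R i) \<le> block_index R' (R (i + 1))"
    "block_index R' (R (i + 1)) \<le> block_index R' (R i) + int gap"
proof -
  let ?f = "\<sigma> ^^ n" and ?J = "\<lambda>i. block_index R' (R i)"
  have f: "word_morphism ?f" by (rule word_morphism_funpow[OF morph])
  have v: "v \<in> X" "img ?f v R y" and v': "v' \<in> X" "img ?f v' R' y"
    using assms by (auto simp: factorizations_def)
  note J = block_index[OF v'(2), of "R i"] block_index[OF v'(2), of "R (i + 1)"]
  have "R' (?J i) < R' (?J (i + 1) + 1)" using J img_le_step[OF v(2), of i] by linarith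
  from img_less_cancel[OF v'(2) this] show "?J i \<le> ?J (i + 1)" by simp
  have "R' (?J (i + 1)) < R' (?J i + 1 + int gap)"
    using J img_step_le[OF f v, of i 1] img_step_ge[OF f v', of "?J i + 1" 1] by simp
  from img_less_cancel[OF v'(2) this] show "?J (i + 1) \<le> ?J i + int gap" by simp
qed

text \<open>Translates the relative position of the two factorizations into an occurrence of one
  finite word in another. The slack of \<open>max_length (\<sigma> ^^ n)\<close> leaves room for a
  competing offset, as \<open>offset_unique\<close> requires.\<close>

lemma offset_context:
  assumes "factorizations n v v' R R' y" "local_context v v' R R' i = (w, w')"
    and d: "d = R i - R' (block_index R' (R i))"
  shows "0 \<le> d" "d < int (max_length (\<sigma> ^^ n))"
    "int (length ((\<sigma> ^^ n) w)) + int (max_length (\<sigma> ^^ n)) \<le> int (length ((\<sigma> ^^ n) w'))"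
    "take (length ((\<sigma> ^^ n) w)) (drop (nat d) ((\<sigma> ^^ n) w')) = (\<sigma> ^^ n) w"
proof -
  let ?f = "\<sigma> ^^ n" and ?j = "block_index R' (R i)"
  have f: "word_morphism ?f" by (rule word_morphism_funpow[OF morph])
  have v: "v \<in> X" "img ?f v R y" and v': "v' \<in> X" "img ?f v' R' y"
    using assms by (auto simp: factorizations_def)
  have w: "w = seg v i (i + int rec_length)" and w': "w' = seg v' ?j (?j + int context_length)"
    using assms(2) by (auto simp: local_context_def)
  note J = block_index[OF v'(2), of "R i"]
  show 1: "0 \<le> d" using J by (simp add: d)
  show 2: "d < int (max_length ?f)"
    using J img_step_le[OF f v', of ?j 1] by (simp add: d)
  have fw: "seg y (R i) (R (i + int rec_length)) = ?f w"
    unfolding w by (rule img_seg[OF v(2) f]) simp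
  have fw': "seg y (R' ?j) (R' (?j + int context_length)) = ?f w'"
    unfolding w' by (rule img_seg[OF v'(2) f]) simp
  have lw: "R (i + int rec_length) = R i + int (length (?f w))"
    unfolding w by (rule img_diff[OF v(2) f]) simp
  have lw': "R' (?j + int context_length) = R' ?j + int (length (?f w'))"
    unfolding w' by (rule img_diff[OF v'(2) f]) simp
  show 3: "int (length (?f w)) + int (max_length ?f) \<le> int (length (?f w'))"
    using img_step_le[OF f v, of i rec_length] img_step_ge[OF f v', of ?j "rec_length + 1"]
    unfolding lw lw'[unfolded context_length_def] by simp
  have "take (nat (R (i + int rec_length) - R i)) (drop (nat (R i - R' ?j)) (?f w')) = ?f w"
    unfolding fw[symmetric] fw'[symmetric]
    by (rule take_drop_seg) (use J 2 3 lw lw' d in linarith)+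
  then show "take (length (?f w)) (drop (nat d) (?f w')) = ?f w" by (simp add: lw d)
qed

text \<open>Equal contexts with unequal offsets would place the same word at two offsets in the same
  word, which \<open>offset_unique\<close> excludes. Thus the offset is a function of the
  context.\<close>

lemma offset_determined:
  assumes F: "factorizations n v v' R R' y"
    and "local_context v v' R R' i = local_context v v' R R' k"
  shows "R i - R' (block_index R' (R i)) = R k - R' (block_index R' (R k))"
proof -
  let ?d = "\<lambda>i. R i - R' (block_index R' (R i))"
  have "\<not> ?d i < ?d k" if eq: "local_context v v' R R' i = local_context v v' R R' k" for i k
  proof
    assume less: "?d i < ?d k"
    obtain w w' where w: "local_context v v' R R' i = (w, w')" by fastforce
    note i = offset_context[OF F w refl] and k = offset_context[OF F w[unfolded eq] refl]
    have "sublist u w" if "u \<in> words (gap + 1)" for u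
      using w rec_length[OF _ that, of v i] F by (simp add: local_context_def factorizations_def)
    then show False
      by (rule offset_unique[of w "nat (?d i)" "nat (?d k)" n w'])
        (use i k less in \<open>auto simp: nat_less_iff\<close>)
  qed
  from this[OF assms(2)] this[OF assms(2)[symmetric]] show ?thesis by linarith
qed

text \<open>Every index \<open>i\<close> of the pair \<open>u\<close>, \<open>u'\<close> is matched
  with an index \<open>k i\<close> of the pair \<open>v\<close>, \<open>v'\<close> showing the same
  transition, and the offset \<open>e i\<close> is taken from there. The deviation of the cuts
  \<open>Q\<close>, \<open>Q'\<close> from these offsets is constant in \<open>i\<close>, which
  gives one translation \<open>c\<close> for all blocks.\<close>

lemma transition_transfer:
  assumes F: "factorizations n v v' R R' y" and F2: "factorizations m u u' S S' s"
    and sub: "range (transition u u' S S') \<subseteq> range (transition v v' R R')"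
    and z: "img (\<sigma> ^^ n) u Q z" and z': "img (\<sigma> ^^ n) u' Q' z'"
  shows "\<exists>c. \<forall>t. z t = z' (t - c)"
proof -
  let ?f = "\<sigma> ^^ n" and ?J = "\<lambda>k. block_index R' (R k)" and ?K = "\<lambda>i. block_index S' (S i)"
  have f: "word_morphism ?f" by (rule word_morphism_funpow[OF morph])
  have v: "v \<in> X" "img ?f v R y" and v': "v' \<in> X" "img ?f v' R' y"
    using F by (auto simp: factorizations_def)
  have "\<exists>k. transition v v' R R' k = transition u u' S S' i" for i
    using sub by (metis (no_types, lifting) rangeE rangeI subsetD)
  then obtain k where k: "\<And>i. transition v v' R R' (k i) = transition u u' S S' i" by metis
  have ctx: "local_context v v' R R' (k i) = local_context u u' S S' i"
    and ctx1: "local_context v v' R R' (k i + 1) = local_context u u' S S' (i + 1)" for i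
    using k[of i] by (simp_all add: transition_def)
  have stp: "?K (i + 1) - ?K i = ?J (k i + 1) - ?J (k i)" for i
    using k[of i] block_index_step(1)[OF F, of "k i"] block_index_step(1)[OF F2, of i]
    by (simp add: transition_def eq_nat_nat_iff)
  define e where "e i = R (k i) - R' (?J (k i))" for i
  \<comment> \<open>The indices \<open>k (i + 1)\<close> and \<open>k i + 1\<close> may differ, but
    they carry the same context, hence the same offset.\<close>
  have e1: "R (k i + 1) - R' (?J (k i + 1)) = e (i + 1)" for i
    unfolding e_def by (rule offset_determined[OF F]) (simp add: ctx ctx1)
  have step: "Q (i + 1) - Q' (?K (i + 1)) - e (i + 1) = Q i - Q' (?K i) - e i" for i
  proof -
    have "seg v (k i) (k i + int rec_length) = seg u i (i + int rec_length)"
      using ctx[of i] by (simp add: local_context_def)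
    from seg_eqD[OF this, of "k i"] have "v (k i) = u i" using rec_length_pos by simp
    then have 1: "R (k i + 1) - R (k i) = Q (i + 1) - Q i"
      using img_step[OF v(2), of "k i"] img_step[OF z, of i] by simp
    define j where "j = ?J (k i + 1) - ?J (k i)"
    have j: "0 \<le> j" "j \<le> int gap" using block_index_step[OF F, of "k i"] by (simp_all add: j_def)
    have "gap \<le> context_length" by (simp add: context_length_def)
    with j have j': "j \<le> int context_length" by linarith
    have ctx': "seg v' (?J (k i)) (?J (k i) + int context_length) =
        seg u' (?K i) (?K i + int context_length)"
      using ctx[of i] by (simp add: local_context_def)
    have "seg v' (?J (k i)) (?J (k i) + j) = seg u' (?K i) (?K i + j)"
      by (rule seg_eqI) (use seg_eqD[OF ctx'] j' in auto)
    then have "R' (?J (k i) + j) - R' (?J (k i)) = Q' (?K i + j) - Q' (?K i)"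
      using img_diff[OF v'(2) f, of "?J (k i)" "?J (k i) + j"]
        img_diff[OF z' f, of "?K i" "?K i + j"] j by simp
    moreover have "?J (k i) + j = ?J (k i + 1)" "?K i + j = ?K (i + 1)"
      using stp[of i] by (simp_all add: j_def)
    ultimately have "R' (?J (k i + 1)) - R' (?J (k i)) = Q' (?K (i + 1)) - Q' (?K i)" by simp
    with 1 e1[of i] show ?thesis by (simp add: e_def)
  qed
  define c where "c = Q 0 - Q' (?K 0) - e 0"
  have c: "Q i - Q' (?K i) - e i = c" for i
  proof (induction i rule: int_induct[where k = 0])
    case (step1 i)
    then show ?case using step[of i] by simp
  next
    case (step2 i)
    then show ?case using step[of "i - 1"] by simp
  qed (simp add: c_def)
  have "z t = z' (t - c)" for t
  proof -
    obtain i where i: "Q i \<le> t" "t < Q (i + 1)" by (rule img_blockE[OF z])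
    define w where "w = seg u i (i + int rec_length)"
    define w' where "w' = seg u' (?K i) (?K i + int context_length)"
    have "local_context v v' R R' (k i) = (w, w')"
      using ctx[of i] by (simp add: local_context_def w_def w'_def)
    \<comment> \<open>The position of \<open>?f w\<close> inside \<open>?f w'\<close> is a fact
      about finite words; it was obtained in \<open>y\<close> and is now used for \<open>z\<close>
      and \<open>z'\<close>.\<close>
    note o = offset_context[OF F this e_def]
    have fw: "seg z (Q i) (Q (i + int rec_length)) = ?f w"
      unfolding w_def by (rule img_seg[OF z f]) simp
    have fw': "seg z' (Q' (?K i)) (Q' (?K i + int context_length)) = ?f w'"
      unfolding w'_def by (rule img_seg[OF z' f]) simp
    have lw: "Q (i + int rec_length) = Q i + int (length (?f w))"
      unfolding w_def by (rule img_diff[OF z f]) simp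
    have lw': "Q' (?K i + int context_length) = Q' (?K i) + int (length (?f w'))"
      unfolding w'_def by (rule img_diff[OF z' f]) simp
    let ?a = "Q' (?K i) + e i"
    have "take (nat (?a + int (length (?f w)) - ?a)) (drop (nat (?a - Q' (?K i))) (?f w')) =
        seg z' ?a (?a + int (length (?f w)))"
      unfolding fw'[symmetric] by (rule take_drop_seg) (use o lw' in linarith)+
    then have "seg z (Q i) (Q (i + int rec_length)) = seg z' ?a (?a + int (length (?f w)))"
      using o(4) fw by simp
    moreover have "t < Q (i + int rec_length)"
      using i(2) img_mono[OF z, of "i + 1" "i + int rec_length"] rec_length_pos by linarith
    ultimately have "z t = z' (t + (?a - Q i))" using seg_eqD i(1) by metis
    moreover have "t + (?a - Q i) = t - c" using c[of i] by simp
    ultimately show ?thesis by simp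
  qed
  then show ?thesis by blast
qed

text \<open>The preimages of \<open>x\<close> and \<open>x'\<close> at level \<open>n\<close> give
  two factorizations of \<open>y\<close> at level \<open>Suc n\<close>. Their transitions lie in a
  finite set independent of \<open>n\<close>, so two levels have the same set of transitions, and
  \<open>transition_transfer\<close> applies.\<close>

theorem same_orbit_if_same_image:
  assumes x: "x \<in> X" "img \<sigma> x A y" and x': "x' \<in> X" "img \<sigma> x' A' y"
  shows "\<exists>d. \<forall>i. x' i = x (i + d)"
proof -
  have "\<exists>v P. v \<in> X \<and> img (\<sigma> ^^ n) v P x" for n using preimage_pow_exists[OF x(1)] by metis
  then obtain v P where v: "\<And>n. v n \<in> X" "\<And>n. img (\<sigma> ^^ n) (v n) (P n) x" by metis
  have "\<exists>v P. v \<in> X \<and> img (\<sigma> ^^ n) v P x'" for n using preimage_pow_exists[OF x'(1)] by metis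
  then obtain v' P' where v': "\<And>n. v' n \<in> X" "\<And>n. img (\<sigma> ^^ n) (v' n) (P' n) x'" by metis
  define R where "R n i = A (P n i)" for n i
  define R' where "R' n i = A' (P' n i)" for n i
  have F: "factorizations (Suc n) (v n) (v' n) (R n) (R' n) y" for n
    unfolding factorizations_def R_def R'_def funpow.simps
    using v v' img_comp[OF v(2) x(2) morph] img_comp[OF v'(2) x'(2) morph] by blast
  define T where "T n = range (transition (v n) (v' n) (R n) (R' n))" for n
  let ?W = "\<lambda>k. {w :: 'a list. length w = k}"
  let ?C = "?W rec_length \<times> ?W context_length"
  have "transition (v n) (v' n) (R n) (R' n) i \<in> ?C \<times> {..gap} \<times> ?C" for n i
    using block_index_step[OF F, of n i] by (simp add: transition_def local_context_def)
  then have "T n \<in> Pow (?C \<times> {..gap} \<times> ?C)" for n unfolding T_def by blast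
  moreover have "finite (Pow (?C \<times> {..gap} \<times> ?C))"
    using finite_lists_length_eq[of "UNIV :: 'a set"] by simp
  ultimately have "finite (range T)" by (meson finite_subset image_subsetI)
  then have "\<not> inj T" using finite_imageD infinite_UNIV_nat by blast
  then obtain n m where nm: "T n = T m" "n < m" unfolding inj_def by (metis nat_neq_iff)
  obtain Q z where z: "img (\<sigma> ^^ Suc n) (v m) Q z" "z \<in> X" by (rule image_pow_exists[OF v(1)])
  obtain Q' z' where z': "img (\<sigma> ^^ Suc n) (v' m) Q' z'" "z' \<in> X"
    by (rule image_pow_exists[OF v'(1)])
  obtain c where c: "\<And>t. z t = z' (t - c)"
    using transition_transfer[OF F[of n] F[of m] _ z(1) z'(1)] nm(1) unfolding T_def by blast
  \<comment> \<open>As \<open>n < m\<close>, the level \<open>Suc n\<close> of \<open>z\<close> and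
    \<open>z'\<close> does not exceed \<open>m\<close>. The remaining power of \<sigma> therefore
    leads to \<open>x\<close> and \<open>x'\<close> themselves, and not only to their common image
    \<open>y\<close>.\<close>
  let ?h = "\<sigma> ^^ (m - Suc n)"
  have h: "word_morphism ?h" "word_morphism (\<sigma> ^^ m)" by (rule word_morphism_funpow[OF morph])+
  have hm: "?h \<circ> \<sigma> ^^ Suc n = \<sigma> ^^ m"
    unfolding funpow_add[symmetric] using nm(2) by simp
  obtain B r where r: "img ?h z B r" by (rule image_pow_exists[OF z(2)])
  obtain B' r' where r': "img ?h z' B' r'" by (rule image_pow_exists[OF z'(2)])
  have im: "img (\<sigma> ^^ m) (v m) (\<lambda>i. B (Q i)) r" "img (\<sigma> ^^ m) (v' m) (\<lambda>i. B' (Q' i)) r'"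
    using img_comp[OF z(1) r h(1)] img_comp[OF z'(1) r' h(1)] unfolding hm by blast+
  obtain a where a: "\<And>t. x (t + a) = r t"
    by (rule img_unique[OF im(1) v(2)[of m] h(2), of 0]) auto
  obtain a' where a': "\<And>t. r' (t + a') = x' t"
    by (rule img_unique[OF v'(2)[of m] im(2) h(2), of 0]) auto
  obtain b where b: "\<And>t. r' (t + b) = r t"
    by (rule img_unique[OF r r' h(1), of "- c"]) (use c in auto)
  have "x' i = x (i + (a' - b + a))" for i
  proof -
    have "x' i = r' ((i + a' - b) + b)" by (simp add: a')
    also have "\<dots> = r (i + a' - b)" by (rule b)
    also have "\<dots> = x (i + a' - b + a)" by (rule a[symmetric])
    finally show ?thesis by (simp add: algebra_simps)
  qed
  then show ?thesis by blast
qed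

end

section \<open>Bounded letters\<close>

definition bounded_letter :: "('a list \<Rightarrow> 'a list) \<Rightarrow> 'a \<Rightarrow> bool" where
  "bounded_letter \<sigma> a \<longleftrightarrow> (\<exists>K. \<forall>n. length ((\<sigma> ^^ n) [a]) \<le> K)"

definition has_powers :: "('a list \<Rightarrow> 'a list) \<Rightarrow> bool" where
  "has_powers \<sigma> \<longleftrightarrow> (\<exists>u. u \<noteq> [] \<and> (\<forall>k. concat (replicate k u) \<in> morphism_language \<sigma>))"

lemma funpow_Suc_word: "(f ^^ Suc n) w = (f ^^ n) (f w)"
  by (simp add: funpow_Suc_right del: funpow.simps)

lemma funpow_add_word: "(f ^^ (m + n)) w = (f ^^ m) ((f ^^ n) w)"
  by (simp add: funpow_add)

text \<open>The shift does not enter here, so that the results can also be instantiated with the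
  reversed morphism.\<close>

locale letter_growth =
  fixes \<sigma> :: "'a::finite list \<Rightarrow> 'a list"
  assumes morph: "word_morphism \<sigma>"
begin

abbreviation bdd :: "'a \<Rightarrow> bool" where "bdd \<equiv> bounded_letter \<sigma>"

lemma bdd_bound: obtains K where "\<And>a n. bdd a \<Longrightarrow> length ((\<sigma> ^^ n) [a]) \<le> K"
proof -
  have "\<exists>K. bdd a \<longrightarrow> (\<forall>n. length ((\<sigma> ^^ n) [a]) \<le> K)" for a by (auto simp: bounded_letter_def)
  then obtain K where K: "\<And>a n. bdd a \<Longrightarrow> length ((\<sigma> ^^ n) [a]) \<le> K a" by metis
  have "K a \<le> (\<Sum>a\<in>UNIV. K a)" for a by (rule member_le_sum) auto
  then show ?thesis using K by (intro that[of "\<Sum>a\<in>UNIV. K a"]) (meson order_trans)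
qed

lemma bdd_image_iff: "bdd a \<longleftrightarrow> (\<forall>b\<in>set (\<sigma> [a]). bdd b)"
proof
  assume "bdd a"
  then obtain K where K: "\<And>n. length ((\<sigma> ^^ n) [a]) \<le> K" by (auto simp: bounded_letter_def)
  have "length ((\<sigma> ^^ n) [b]) \<le> K" if "b \<in> set (\<sigma> [a])" for b n
    using word_morphism_member_le[OF word_morphism_funpow[OF morph] that, of n] K[of "Suc n"]
    by (simp add: funpow_Suc_word del: funpow.simps)
  then show "\<forall>b\<in>set (\<sigma> [a]). bdd b" by (auto simp: bounded_letter_def)
next
  assume b: "\<forall>b\<in>set (\<sigma> [a]). bdd b"
  obtain K where K: "\<And>a n. bdd a \<Longrightarrow> length ((\<sigma> ^^ n) [a]) \<le> K" by (rule bdd_bound) (rule that)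
  have "length ((\<sigma> ^^ n) [a]) \<le> max 1 (length (\<sigma> [a]) * K)" for n
  proof (cases n)
    case (Suc m)
    have "length ((\<sigma> ^^ m) (\<sigma> [a])) \<le> length (\<sigma> [a]) * K"
      by (rule length_word_morphism_le[OF word_morphism_funpow[OF morph]]) (use b K in auto)
    then show ?thesis by (simp add: Suc funpow_Suc_word del: funpow.simps)
  qed simp
  then show "bdd a" unfolding bounded_letter_def by blast
qed

lemma bdd_pow_iff: "(\<forall>b\<in>set ((\<sigma> ^^ n) w). bdd b) \<longleftrightarrow> (\<forall>b\<in>set w. bdd b)"
proof (induction n)
  case (Suc n)
  have "(\<forall>b\<in>set (\<sigma> v). bdd b) \<longleftrightarrow> (\<forall>b\<in>set v. bdd b)" for v
  proof -
    have "set (\<sigma> v) = (\<Union>a\<in>set v. set (\<sigma> [a]))"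
      using arg_cong[OF word_morphism_concat[OF morph, of v], of set] by simp
    then have "(\<forall>b\<in>set (\<sigma> v). bdd b) \<longleftrightarrow> (\<forall>a\<in>set v. \<forall>b\<in>set (\<sigma> [a]). bdd b)" by simp
    also have "\<dots> \<longleftrightarrow> (\<forall>a\<in>set v. bdd a)" by (rule ball_cong[OF refl]) (rule bdd_image_iff[symmetric])
    finally show ?thesis .
  qed
  with Suc show ?case by simp
qed simp

section \<open>Bounded letters at the start of iterated images\<close>

definition pre :: "nat \<Rightarrow> 'a \<Rightarrow> 'a list" where
  "pre n g = takeWhile bdd ((\<sigma> ^^ n) [g])"

definition lead :: "nat \<Rightarrow> 'a \<Rightarrow> 'a" where
  "lead n g = hd (dropWhile bdd ((\<sigma> ^^ n) [g]))"

lemma pow_split: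
  assumes "\<not> bdd g"
  obtains v where "(\<sigma> ^^ n) [g] = pre n g @ lead n g # v" "\<not> bdd (lead n g)"
proof -
  have "\<exists>b\<in>set ((\<sigma> ^^ n) [g]). \<not> bdd b" using bdd_pow_iff[of n "[g]"] assms by auto
  then have ne: "dropWhile bdd ((\<sigma> ^^ n) [g]) \<noteq> []" by (simp add: dropWhile_eq_Nil_conv)
  have "(\<sigma> ^^ n) [g] = pre n g @ dropWhile bdd ((\<sigma> ^^ n) [g])" by (simp add: pre_def)
  then show ?thesis using that ne hd_dropWhile[OF ne] unfolding lead_def
    by (metis list.collapse)
qed

lemma pre_bdd: "b \<in> set (pre n g) \<Longrightarrow> bdd b"
  unfolding pre_def by (rule set_takeWhileD[THEN conjunct2])

text \<open>Images of bounded letters contain only bounded letters, so the first unbounded letter at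
  level \<open>m + n\<close> arises from the first unbounded letter at level
  \<open>n\<close>.\<close>

lemma pre_lead_add:
  assumes g: "\<not> bdd g"
  shows "pre (m + n) g = (\<sigma> ^^ m) (pre n g) @ pre m (lead n g)"
    "lead (m + n) g = lead m (lead n g)"
proof -
  have f: "word_morphism (\<sigma> ^^ m)" by (rule word_morphism_funpow[OF morph])
  obtain v where v: "(\<sigma> ^^ n) [g] = pre n g @ lead n g # v" "\<not> bdd (lead n g)"
    by (rule pow_split[OF g])
  obtain v' where v': "(\<sigma> ^^ m) [lead n g] = pre m (lead n g) @ lead m (lead n g) # v'"
    "\<not> bdd (lead m (lead n g))"
    by (rule pow_split[OF v(2)])
  have "(\<sigma> ^^ (m + n)) [g] = (\<sigma> ^^ m) (pre n g @ [lead n g] @ v)"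
    by (simp add: funpow_add_word v(1))
  also have "\<dots> = ((\<sigma> ^^ m) (pre n g) @ pre m (lead n g)) @ lead m (lead n g) # v' @ (\<sigma> ^^ m) v"
    by (simp only: word_morphism_append[OF f] v'(1)) simp
  finally have e: "(\<sigma> ^^ (m + n)) [g] = \<dots>" .
  have b: "\<forall>b\<in>set ((\<sigma> ^^ m) (pre n g) @ pre m (lead n g)). bdd b"
    using bdd_pow_iff[of m "pre n g"] pre_bdd by auto
  show "pre (m + n) g = (\<sigma> ^^ m) (pre n g) @ pre m (lead n g)"
    unfolding pre_def[of "m + n"] e using b v'(2) by (subst takeWhile_append2) auto
  show "lead (m + n) g = lead m (lead n g)"
    unfolding lead_def[of "m + n"] e using b v'(2) by (subst dropWhile_append2) auto
qed

lemma eventually_periodic: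
  obtains N Q where "0 < Q" "\<And>w j. (\<forall>b\<in>set w. bdd b) \<Longrightarrow> (\<sigma> ^^ (j * Q + N)) w = (\<sigma> ^^ N) w"
    "\<And>g. lead (Q + N) g = lead N g"
proof -
  obtain K where K: "\<And>a n. bdd a \<Longrightarrow> length ((\<sigma> ^^ n) [a]) \<le> K" by (rule bdd_bound) (rule that)
  \<comment> \<open>Images of bounded letters and leading letters are recorded together, so that one
    repetition yields a common period; \<open>[]\<close> is a filler at unbounded letters.\<close>
  define \<phi> where "\<phi> n = ((\<lambda>a. if bdd a then (\<sigma> ^^ n) [a] else []), lead n)" for n
  let ?W = "{w :: 'a list. length w \<le> K}"
  have "\<phi> n \<in> (\<Pi>\<^sub>E a\<in>UNIV. ?W) \<times> UNIV" for n using K by (auto simp: \<phi>_def PiE_iff)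
  moreover have "finite ((\<Pi>\<^sub>E a\<in>(UNIV :: 'a set). ?W) \<times> (UNIV :: ('a \<Rightarrow> 'a) set))"
    using finite_lists_length_le[of "UNIV :: 'a set" K] by (intro finite_cartesian_product finite_PiE) auto
  ultimately have "finite (range \<phi>)" by (meson finite_subset image_subsetI)
  then have "\<not> inj \<phi>" using finite_imageD infinite_UNIV_nat by blast
  then obtain N M where NM: "\<phi> N = \<phi> M" "N < M" unfolding inj_def by (metis nat_neq_iff)
  define Q where "Q = M - N"
  have M: "M = Q + N" using NM(2) by (simp add: Q_def)
  have fst: "(\<lambda>a. if bdd a then (\<sigma> ^^ N) [a] else []) = (\<lambda>a. if bdd a then (\<sigma> ^^ (Q + N)) [a] else [])"
    and snd: "lead N = lead (Q + N)"
    using NM(1) unfolding \<phi>_def M prod.inject by blast+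
  have 1: "(\<sigma> ^^ (Q + N)) [a] = (\<sigma> ^^ N) [a]" if "bdd a" for a
    using fun_cong[OF fst, of a] that by simp
  have 2: "(\<sigma> ^^ (Q + N)) w = (\<sigma> ^^ N) w" if "\<forall>b\<in>set w. bdd b" for w
  proof -
    have "map (\<lambda>a. (\<sigma> ^^ (Q + N)) [a]) w = map (\<lambda>a. (\<sigma> ^^ N) [a]) w" using 1 that by auto
    then show ?thesis
      using word_morphism_concat[OF word_morphism_funpow[OF morph], of _ w] by metis
  qed
  have "(\<sigma> ^^ (j * Q + N)) w = (\<sigma> ^^ N) w" if "\<forall>b\<in>set w. bdd b" for w j
  proof (induction j)
    case (Suc j)
    have "(\<sigma> ^^ (Suc j * Q + N)) w = (\<sigma> ^^ (j * Q)) ((\<sigma> ^^ (Q + N)) w)"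
      by (simp add: funpow_add_word[symmetric] algebra_simps)
    also have "\<dots> = (\<sigma> ^^ (j * Q + N)) w" by (simp only: 2[OF that] funpow_add_word[of "j * Q" N])
    finally show ?case using Suc by simp
  qed simp
  moreover have "lead (Q + N) g = lead N g" for g by (simp add: snd)
  moreover have "0 < Q" using NM(2) by (simp add: Q_def)
  ultimately show ?thesis using that by blast
qed

text \<open>The leading letter \<open>h\<close> returns every \<open>Q\<close> levels, and from
  level \<open>N\<close> on each return puts one more copy of \<open>u\<close> in front. If
  \<open>u\<close> is nonempty, all its powers are in the language; if \<open>u = []\<close>, then
  \<open>pre n h\<close> repeats with period \<open>Q\<close> for
  \<open>n \<ge> N + Q\<close>.\<close>

lemma pre_bounded:
  assumes g: "\<not> bdd g" and np: "\<not> has_powers \<sigma>"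
  shows "\<exists>K. \<forall>n. length (pre n g) \<le> K"
proof -
  obtain N Q where Q: "0 < Q"
    and per: "\<And>w j. (\<forall>b\<in>set w. bdd b) \<Longrightarrow> (\<sigma> ^^ (j * Q + N)) w = (\<sigma> ^^ N) w"
    and lead: "\<And>g. lead (Q + N) g = lead N g"
    by (rule eventually_periodic) (rule that)
  define h where "h = lead N g"
  have h: "\<not> bdd h" unfolding h_def using pow_split[OF g] by blast
  have hQ: "lead Q h = h" unfolding h_def using pre_lead_add(2)[OF g, of Q N] lead[of g] by simp
  have step: "pre (m + Q) h = (\<sigma> ^^ m) (pre Q h) @ pre m h" for m
    using pre_lead_add(1)[OF h, of m Q] hQ by simp
  define u where "u = (\<sigma> ^^ N) (pre Q h)"
  have pw: "pre (k * Q + N) h = concat (replicate k u) @ pre N h" for k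
  proof (induction k)
    case (Suc k)
    have "pre (Suc k * Q + N) h = (\<sigma> ^^ (k * Q + N)) (pre Q h) @ pre (k * Q + N) h"
      using step[of "k * Q + N"] by (simp add: algebra_simps)
    then show ?case using Suc per[of "pre Q h" k] pre_bdd by (simp add: u_def)
  qed simp
  have "u = []"
  proof (rule ccontr)
    assume "u \<noteq> []"
    moreover have "concat (replicate k u) \<in> morphism_language \<sigma>" for k
    proof -
      obtain v where "(\<sigma> ^^ (k * Q + N)) [h] = pre (k * Q + N) h @ lead (k * Q + N) h # v"
        by (rule pow_split[OF h])
      then have "sublist (concat (replicate k u)) ((\<sigma> ^^ (k * Q + N)) [h])"
        by (simp add: pw sublist_append_rightI)
      then show ?thesis unfolding morphism_language_def by blast
    qed
    ultimately show False using np by (auto simp: has_powers_def)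
  qed
  then have u: "(\<sigma> ^^ (m + N)) (pre Q h) = []" for m
    using word_morphism_Nil[OF word_morphism_funpow[OF morph]] by (simp add: u_def funpow_add_word)
  have pre_h: "length (pre n h) \<le> (\<Sum>i<N + Q. length (pre i h))" for n
  proof (induction n rule: less_induct)
    case (less n)
    show ?case
    proof (cases "n < N + Q")
      case True
      then show ?thesis by (intro member_le_sum) auto
    next
      case False
      then have "pre n h = pre (n - Q) h"
        using step[of "n - Q"] u[of "n - Q - N"] by simp
      then show ?thesis using less[of "n - Q"] False Q by simp
    qed
  qed
  obtain K where K: "\<And>a n. bdd a \<Longrightarrow> length ((\<sigma> ^^ n) [a]) \<le> K" by (rule bdd_bound) (rule that)
  have "length (pre n g) \<le> (\<Sum>i<N. length (pre i g)) +
      (length (pre N g) * K + (\<Sum>i<N + Q. length (pre i h)))" for n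
  proof (cases "n < N")
    case True
    then have "length (pre n g) \<le> (\<Sum>i<N. length (pre i g))" by (intro member_le_sum) auto
    then show ?thesis by simp
  next
    case False
    then have "pre n g = (\<sigma> ^^ (n - N)) (pre N g) @ pre (n - N) h"
      using pre_lead_add(1)[OF g, of "n - N" N] by (simp add: h_def)
    moreover have "length ((\<sigma> ^^ (n - N)) (pre N g)) \<le> length (pre N g) * K"
      by (rule length_word_morphism_le[OF word_morphism_funpow[OF morph]]) (use K pre_bdd in auto)
    ultimately show ?thesis using pre_h[of "n - N"] by simp
  qed
  then show ?thesis by blast
qed

end

section \<open>Reversal and long words over bounded letters\<close>

lemma funpow_conj_rev:
  fixes \<sigma> :: "'a list \<Rightarrow> 'a list"
  shows "((\<lambda>w. rev (\<sigma> (rev w))) ^^ n) w = rev ((\<sigma> ^^ n) (rev w))"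
  by (induction n) simp_all

lemma rev_concat_replicate: "rev (concat (replicate k u)) = concat (replicate k (rev u))"
  by (simp add: rev_concat)

context letter_growth
begin

text \<open>Conjugation by \<open>rev\<close> turns suffixes into prefixes and preserves bounded
  letters and the absence of powers.\<close>

lemma suf_bounded:
  assumes g: "\<not> bdd g" and np: "\<not> has_powers \<sigma>"
  shows "\<exists>K. \<forall>n. length (takeWhile bdd (rev ((\<sigma> ^^ n) [g]))) \<le> K"
proof -
  let ?\<tau> = "\<lambda>w. rev (\<sigma> (rev w))"
  have "word_morphism ?\<tau>" using morph by (simp add: word_morphism_def)
  then interpret R: letter_growth ?\<tau> by unfold_locales
  have pow: "(?\<tau> ^^ n) [a] = rev ((\<sigma> ^^ n) [a])" for n a
    using funpow_conj_rev[of n \<sigma> "[a]"] by simp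
  have bdd: "R.bdd = bdd" by (simp add: bounded_letter_def fun_eq_iff pow)
  have "\<not> has_powers ?\<tau>"
  proof
    assume "has_powers ?\<tau>"
    then obtain u where u: "u \<noteq> []" "\<And>k. concat (replicate k u) \<in> morphism_language ?\<tau>"
      by (auto simp: has_powers_def)
    have "concat (replicate k (rev u)) \<in> morphism_language \<sigma>" for k
    proof -
      obtain n a where "sublist (concat (replicate k u)) (rev ((\<sigma> ^^ n) [a]))"
        using u(2)[of k] by (auto simp: morphism_language_def pow)
      then have "sublist (concat (replicate k (rev u))) ((\<sigma> ^^ n) [a])"
        using sublist_rev_right rev_concat_replicate by metis
      then show ?thesis unfolding morphism_language_def by blast
    qed
    then show False using np u(1) unfolding has_powers_def by (metis rev_is_Nil_conv)
  qed
  then show ?thesis using R.pre_bounded[of g] g by (simp add: R.pre_def pow bdd)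
qed

text \<open>Induction on the level. A word over bounded letters in the level-\<open>n\<close> image
  of \<sigma>(a) lies inside the image of one letter, or it consists of a suffix of one image, full
  images of bounded letters and a prefix of another image. All these pieces are bounded
  independently of the level.\<close>

lemma bdd_words_bounded:
  assumes np: "\<not> has_powers \<sigma>"
  obtains C where "\<And>w. w \<in> morphism_language \<sigma> \<Longrightarrow> (\<forall>b\<in>set w. bdd b) \<Longrightarrow> length w \<le> C"
proof -
  obtain Kb where Kb: "\<And>a n. bdd a \<Longrightarrow> length ((\<sigma> ^^ n) [a]) \<le> Kb" by (rule bdd_bound) (rule that)
  have "\<exists>K. \<not> bdd g \<longrightarrow> (\<forall>n. length (pre n g) \<le> K \<and>
      length (takeWhile bdd (rev ((\<sigma> ^^ n) [g]))) \<le> K)" for g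
  proof (cases "bdd g")
    case False
    obtain K K' where "\<And>n. length (pre n g) \<le> K"
      "\<And>n. length (takeWhile bdd (rev ((\<sigma> ^^ n) [g]))) \<le> K'"
      using pre_bounded[OF False np] suf_bounded[OF False np] by blast
    then show ?thesis by (intro exI[of _ "max K K'"]) (simp add: max.coboundedI1 max.coboundedI2)
  qed simp
  then obtain K where K: "\<And>g n. \<not> bdd g \<Longrightarrow> length (pre n g) \<le> K g"
    "\<And>g n. \<not> bdd g \<Longrightarrow> length (takeWhile bdd (rev ((\<sigma> ^^ n) [g]))) \<le> K g"
    by metis
  define Kp where "Kp = (\<Sum>g\<in>UNIV. K g)"
  have le: "K g \<le> Kp" for g unfolding Kp_def by (rule member_le_sum) auto
  have pr: "length w \<le> Kp" if g: "\<not> bdd g" "\<forall>b\<in>set w. bdd b" and wp: "prefix w ((\<sigma> ^^ n) [g])" for w n g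
  proof -
    obtain v where "(\<sigma> ^^ n) [g] = w @ v" using wp by (auto simp: prefix_def)
    then have "pre n g = w @ takeWhile bdd v" unfolding pre_def using g(2) by simp
    then show ?thesis using K(1)[OF g(1), of n] le[of g] by simp
  qed
  have su: "length w \<le> Kp" if g: "\<not> bdd g" "\<forall>b\<in>set w. bdd b" and wp: "suffix w ((\<sigma> ^^ n) [g])" for w n g
  proof -
    obtain v where "(\<sigma> ^^ n) [g] = v @ w" using wp by (auto simp: suffix_def)
    then have "takeWhile bdd (rev ((\<sigma> ^^ n) [g])) = rev w @ takeWhile bdd (rev v)"
      using g(2) takeWhile_append2[of "rev w" bdd "rev v"] by simp
    then show ?thesis using K(2)[OF g(1), of n] le[of g] by simp
  qed
  have app: "(\<sigma> ^^ n) (a # v) = (\<sigma> ^^ n) [a] @ (\<sigma> ^^ n) v" for n a v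
    using word_morphism_append[OF word_morphism_funpow[OF morph], of n "[a]" v] by simp
  have prv: "length w \<le> length v * Kb + Kp"
    if "\<forall>b\<in>set w. bdd b" "prefix w ((\<sigma> ^^ n) v)" for w v n
    using that
  proof (induction v arbitrary: w)
    case Nil
    then show ?case by (simp add: word_morphism_Nil[OF word_morphism_funpow[OF morph]])
  next
    case (Cons a v)
    from Cons.prems(2) consider "prefix w ((\<sigma> ^^ n) [a])"
      | w' where "w = (\<sigma> ^^ n) [a] @ w'" "prefix w' ((\<sigma> ^^ n) v)"
      unfolding app[of n a v] prefix_append by blast
    then show ?case
    proof cases
      case 1
      then show ?thesis
        using pr[OF _ Cons.prems(1) 1] Kb[of a n] prefix_length_le[OF 1] by (cases "bdd a") auto
    next
      case 2
      then have "bdd a" using Cons.prems(1) bdd_pow_iff[of n "[a]"] by auto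
      moreover have "length w' \<le> length v * Kb + Kp" using Cons 2 by auto
      ultimately show ?thesis using 2(1) Kb[of a n] by simp
    qed
  qed
  define M where "M = (\<Sum>a\<in>UNIV. length (\<sigma> [a]))"
  have M: "length (\<sigma> [a]) \<le> M" for a unfolding M_def by (rule member_le_sum) auto
  \<comment> \<open>The summand 1 serves level 0, and the rest bounds the words that cross from one
    image into the next, so the induction reproduces the same \<open>C\<close>.\<close>
  define C where "C = 1 + 2 * Kp + M * Kb"
  have sub: "length w \<le> max C (2 * Kp + length v * Kb)"
    if "\<And>a w. a \<in> set v \<Longrightarrow> sublist w ((\<sigma> ^^ n) [a]) \<Longrightarrow> \<forall>b\<in>set w. bdd b \<Longrightarrow> length w \<le> C"
      "\<forall>b\<in>set w. bdd b" "sublist w ((\<sigma> ^^ n) v)" for w v n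
    using that
  proof (induction v arbitrary: w)
    case Nil
    then show ?case by (simp add: word_morphism_Nil[OF word_morphism_funpow[OF morph]])
  next
    case (Cons a v)
    from Cons.prems(3) consider "sublist w ((\<sigma> ^^ n) [a])" | "sublist w ((\<sigma> ^^ n) v)"
      | w1 w2 where "w = w1 @ w2" "suffix w1 ((\<sigma> ^^ n) [a])" "prefix w2 ((\<sigma> ^^ n) v)"
      unfolding app[of n a v] sublist_append by blast
    then show ?case
    proof cases
      case 1
      then show ?thesis using Cons.prems(1)[OF _ 1 Cons.prems(2)] by simp
    next
      case 2
      have "length w \<le> max C (2 * Kp + length v * Kb)"
        by (rule Cons.IH[OF _ Cons.prems(2) 2]) (use Cons.prems(1) in auto)
      then show ?thesis by auto
    next
      case 3
      have "length w1 \<le> max Kp Kb"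
        using su[of a w1 n] 3 Cons.prems(2) Kb[of a n] suffix_length_le[OF 3(2)]
        by (cases "bdd a") auto
      moreover have "length w2 \<le> length v * Kb + Kp"
        by (rule prv[OF _ 3(3)]) (use Cons.prems(2) 3(1) in auto)
      ultimately show ?thesis using 3(1) by auto
    qed
  qed
  have "length w \<le> C" if "\<forall>b\<in>set w. bdd b" "sublist w ((\<sigma> ^^ n) [a])" for w n a
    using that
  proof (induction n arbitrary: w a)
    case 0
    then show ?case using sublist_length_le[of w "[a]"] by (simp add: C_def)
  next
    case (Suc n)
    have "length w \<le> max C (2 * Kp + length (\<sigma> [a]) * Kb)"
      by (rule sub[of "\<sigma> [a]" n w]) (use Suc in \<open>auto simp: funpow_Suc_word simp del: funpow.simps\<close>)
    moreover have "length (\<sigma> [a]) * Kb \<le> M * Kb" using M by simp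
    ultimately show ?case by (auto simp: C_def)
  qed
  then show ?thesis using that[of C] by (auto simp: morphism_language_def)
qed

end

lemma periodic_point_if_has_powers:
  fixes \<sigma> :: "'a list \<Rightarrow> 'a list"
  assumes "has_powers \<sigma>"
  shows "\<exists>x\<in>morphism_shift \<sigma>. \<exists>p>0. \<forall>i. x (i + p) = x i"
proof -
  obtain u where u: "u \<noteq> []" "\<And>k. concat (replicate k u) \<in> morphism_language \<sigma>"
    using assms by (auto simp: has_powers_def)
  define p where "p = int (length u)"
  have p: "0 < p" using u(1) by (simp add: p_def)
  define x where "x i = u ! nat (i mod p)" for i
  have per: "x (i + p) = x i" for i by (simp add: x_def)
  have per': "x (i + k * p) = x i" for i k by (simp add: x_def)
  have pw: "seg x 0 (int k * p) = concat (replicate k u)" for k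
  proof (induction k)
    case (Suc k)
    have "seg x 0 p = u"
      by (rule nth_equalityI) (auto simp: nth_seg p_def x_def)
    moreover have "seg x 0 (int k * p) = seg x p (int (Suc k) * p)"
      by (rule seg_eqI) (auto simp: per algebra_simps)
    moreover have "p \<le> int (Suc k) * p" using p by (simp add: algebra_simps)
    ultimately show ?case using Suc seg_append[of 0 p "int (Suc k) * p" x] p by simp
  qed simp
  have "seg x a b \<in> morphism_language \<sigma>" for a b
  proof (cases "a \<le> b")
    case True
    \<comment> \<open>Since \<open>p\<close> is at least 1, translating by \<open>k * p\<close>
      moves the window into \<open>[0, 2 * k * p]\<close>, where the sequence is a power of
      \<open>u\<close>.\<close>
    define k where "k = max \<bar>a\<bar> \<bar>b\<bar>"
    have k: "k \<le> k * p" using p by (simp add: k_def mult_le_cancel_left1)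
    have "seg x a b = seg x (a + k * p) (b + k * p)"
      by (rule seg_eqI) (auto simp: per')
    moreover have "sublist (seg x (a + k * p) (b + k * p)) (seg x 0 (int (nat (2 * k)) * p))"
    proof (rule sublist_seg)
      have ab: "\<bar>a\<bar> \<le> k" "\<bar>b\<bar> \<le> k" by (simp_all add: k_def)
      then show "0 \<le> a + k * p" using k by linarith
      have "b + k * p \<le> k * p + k * p" using ab k by linarith
      also have "\<dots> = int (nat (2 * k)) * p" using ab by (simp add: algebra_simps)
      finally show "b + k * p \<le> int (nat (2 * k)) * p" .
    qed (use True in simp)
    ultimately show ?thesis
      using morphism_language_sublist u(2)[of "nat (2 * k)"] unfolding pw by metis
  next
    case False
    then show ?thesis using u(2)[of 0] by simp
  qed
  then have "x \<in> morphism_shift \<sigma>" by (simp add: mem_morphism_shift)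
  then show ?thesis using per p by blast
qed

section \<open>Left special sequences and one-sided representations\<close>

context minimal_morphism
begin

section \<open>Growth and linear complexity\<close>

text \<open>Otherwise all letters of \<open>X\<close> are bounded, and the factors of a point are
  arbitrarily long words over bounded letters. As aperiodicity rules out \<open>has_powers\<close>,
  this contradicts \<open>bdd_words_bounded\<close>.\<close>

lemma max_length_unbounded: "\<exists>n. K \<le> max_length (\<sigma> ^^ n)"
proof (rule ccontr)
  assume neg: "\<nexists>n. K \<le> max_length (\<sigma> ^^ n)"
  interpret letter_growth \<sigma> by unfold_locales (rule morph)
  have bdd: "bdd b" if "b \<in> letters" for b
    unfolding bounded_letter_def
    using length_le_max_length[OF that] neg by (metis le_trans nat_le_linear)
  have "\<not> has_powers \<sigma>"
  proof
    assume "has_powers \<sigma>"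
    then obtain x p where "x \<in> X" "p > 0" "\<And>i. x (i + p) = x i"
      using periodic_point_if_has_powers unfolding X_def by blast
    then show False using aperiodic[of x p] by simp
  qed
  then obtain C where C: "\<And>w. w \<in> morphism_language \<sigma> \<Longrightarrow> (\<forall>b\<in>set w. bdd b) \<Longrightarrow> length w \<le> C"
    by (rule bdd_words_bounded) (rule that)
  obtain x where x: "x \<in> X" using X_nonempty by blast
  have "\<forall>b\<in>set (seg x 0 (int C + 1)). bdd b"
    using bdd letters_I[OF x] by (auto simp: seg_def)
  from C[OF X_seg[OF x] this] show False by simp
qed

text \<open>At the least level \<open>n\<close> with
  \<open>N \<le> max_length (\<sigma> ^^ n)\<close>, this maximum is still at most linear in
  \<open>N\<close>. A word of length \<open>N\<close> is then given by one of finitely many words of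
  length \<open>gap + 1\<close> and a starting position in its image.\<close>

lemma linear_complexity: "\<exists>C. \<forall>N\<ge>1. card (words N) \<le> C * N"
proof -
  define M where "M = (\<Sum>a\<in>UNIV. length (\<sigma> [a]))"
  have M: "length (\<sigma> [a]) \<le> M" for a unfolding M_def by (rule member_le_sum) auto
  let ?l = "\<lambda>n. max_length (\<sigma> ^^ n)" and ?D = "card (words (gap + 1))"
  have l0: "?l 0 = 1"
    using max_length_attained[of "\<sigma> ^^ 0"] by fastforce
  have lS: "?l (Suc n) \<le> M * ?l n" for n
  proof -
    obtain b where b: "b \<in> letters" "length ((\<sigma> ^^ Suc n) [b]) = ?l (Suc n)"
      by (rule max_length_attained)
    have "length (\<sigma> ((\<sigma> ^^ n) [b])) \<le> length ((\<sigma> ^^ n) [b]) * M"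
      by (rule length_word_morphism_le[OF morph]) (rule M)
    also have "\<dots> \<le> M * ?l n"
      by (subst mult.commute) (rule mult_le_mono2[OF length_le_max_length[OF b(1)]])
    finally show ?thesis using b(2) by simp
  qed
  have "card (words N) \<le> (?D * ((gap + 1) * (M + 1) + 1)) * N" if N: "1 \<le> N" for N
  proof -
    define n where "n = (LEAST n. N \<le> ?l n)"
    have n: "N \<le> ?l n" unfolding n_def using max_length_unbounded[of N] by (rule LeastI_ex)
    \<comment> \<open>The factor \<open>M + 1\<close> also covers \<open>n = 0\<close>, where the
      longest image has length 1; otherwise the previous level is shorter than
      \<open>N\<close>.\<close>
    have ln: "?l n \<le> (M + 1) * N"
    proof (cases n)
      case 0
      have "?l n = 1" by (simp only: 0 l0)
      then show ?thesis using N by simp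
    next
      case (Suc k)
      then have "\<not> N \<le> ?l k" unfolding n_def by (metis lessI not_less_Least)
      then have "M * ?l k \<le> M * N" by (intro mult_le_mono2) simp
      with lS[of k] have "?l n \<le> M * N" unfolding Suc by (rule le_trans)
      then show ?thesis by simp
    qed
    let ?f = "\<sigma> ^^ n" and ?q = "(gap + 1) * ?l n"
    have f: "word_morphism ?f" by (rule word_morphism_funpow[OF morph])
    have "words N \<subseteq> (\<lambda>(u, q). take N (drop q (?f u))) ` (words (gap + 1) \<times> {..?q})"
    proof
      fix z assume z: "z \<in> words N"
      obtain u where u: "u \<in> words (gap + 1)" "sublist z (?f u)"
        using short_word_in_image[OF z n] by blast
      obtain ps ss where e: "?f u = ps @ z @ ss" using u(2) by (auto simp: sublist_def)
      have "length (?f u) \<le> length u * ?l n"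
        by (rule length_word_morphism_le[OF f], rule length_le_max_length)
          (use u(1) in \<open>auto simp: words_def seg_def letters_I\<close>)
      then have "length ps \<le> ?q" using e length_words[OF u(1)] by simp
      moreover have "z = take N (drop (length ps) (?f u))" using e length_words[OF z] by simp
      ultimately show "z \<in> (\<lambda>(u, q). take N (drop q (?f u))) ` (words (gap + 1) \<times> {..?q})"
        using u(1) by (intro image_eqI[of _ _ "(u, length ps)"]) auto
    qed
    then have "card (words N) \<le> card (words (gap + 1) \<times> {..?q})"
      by (meson card_image_le card_mono finite_SigmaI finite_atMost finite_imageI finite_words le_trans)
    also have "\<dots> = ?D * (?q + 1)" by (simp add: card_cartesian_product)
    also have "\<dots> \<le> ?D * ((gap + 1) * ((M + 1) * N) + N)"
      using ln N by (intro mult_le_mono add_mono order_refl)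
    finally show ?thesis by (simp add: algebra_simps)
  qed
  then show ?thesis by blast
qed

section \<open>Finiteness of left special sequences\<close>

definition left_special :: "(nat \<Rightarrow> 'a) set" where
  "left_special = {t. \<exists>x\<in>X. \<exists>x'\<in>X. right_half x = t \<and> right_half x' = t \<and> x (- 1) \<noteq> x' (- 1)}"

text \<open>Suppose there are \<open>C + 1\<close> left special sequences. From some length on their
  prefixes are distinct, and each has two left extensions, so the complexity grows by at least
  \<open>C + 1\<close> per step, against the bound \<open>C * N\<close>.\<close>

lemma finite_left_special: "finite left_special"
proof (rule ccontr)
  assume inf: "infinite left_special"
  obtain C where C: "\<And>N. 1 \<le> N \<Longrightarrow> card (words N) \<le> C * N" using linear_complexity by blast
  obtain F where F: "F \<subseteq> left_special" "finite F" "card F = C + 1"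
    using infinite_arbitrarily_large[OF inf] by blast
  let ?pr = "\<lambda>N t. map t [0..<N]"
  have "\<exists>n. s \<noteq> t \<longrightarrow> s n \<noteq> t n" for s t :: "nat \<Rightarrow> 'a" by (auto simp: fun_eq_iff)
  then obtain D where D: "\<And>s t :: nat \<Rightarrow> 'a. s \<noteq> t \<Longrightarrow> s (D s t) \<noteq> t (D s t)" by metis
  define N0 where "N0 = 1 + (\<Sum>(s, t)\<in>F \<times> F. D s t)"
  have inj: "inj_on (?pr N) F" if "N0 \<le> N" for N
  proof (rule inj_onI, rule ccontr)
    fix s t assume st: "s \<in> F" "t \<in> F" "?pr N s = ?pr N t" "s \<noteq> t"
    have "D s t \<le> (\<Sum>(s, t)\<in>F \<times> F. D s t)"
      using member_le_sum[of "(s, t)" "F \<times> F" "\<lambda>(s, t). D s t"] st F(2) by simp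
    then have "D s t < N" using that by (simp add: N0_def)
    then have "s (D s t) = t (D s t)" using st(3) by simp
    with D[OF st(4)] show False by simp
  qed
  have step: "card (words N) + (C + 1) \<le> card (words (Suc N))" if N: "N0 \<le> N" for N
  proof -
    have "\<exists>a. a # w \<in> words (Suc N)" if w: "w \<in> words N" for w
    proof -
      obtain x b where "x \<in> X" "w = seg x b (b + int N)" using w by (auto simp: words_def)
      moreover have "seg x (b - 1) (b + int N) = x (b - 1) # seg x b (b + int N)"
        using seg_Cons[of "b - 1" "b + int N" x] by simp
      ultimately have "x (b - 1) # w \<in> words (Suc N)"
        using seg_in_words[of x "b - 1" "b + int N" "Suc N"] by (simp add: nat_add_distrib)
      then show ?thesis ..
    qed
    then obtain e where e: "\<And>w. w \<in> words N \<Longrightarrow> e w # w \<in> words (Suc N)" by metis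
    have spec: "?pr N t \<in> words N \<and> (\<exists>a. a \<noteq> e (?pr N t) \<and> a # ?pr N t \<in> words (Suc N))" if "t \<in> F" for t
    proof -
      obtain x x' where x: "x \<in> X" "x' \<in> X" "right_half x = t" "right_half x' = t" "x (- 1) \<noteq> x' (- 1)"
        using \<open>t \<in> F\<close> F(1) unfolding left_special_def by blast
      have pr: "seg v 0 (int N) = ?pr N t" if "right_half v = t" for v
        by (rule nth_equalityI) (auto simp: nth_seg that[symmetric] right_half_def)
      have "v (- 1) # ?pr N t \<in> words (Suc N)" if "v \<in> X" "right_half v = t" for v
        using seg_in_words[OF that(1), of "- 1" "int N" "Suc N"] seg_Cons[of "- 1" "int N" v] pr[OF that(2)]
        by (simp add: nat_add_distrib)
      then have "x (- 1) # ?pr N t \<in> words (Suc N)" "x' (- 1) # ?pr N t \<in> words (Suc N)"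
        using x by blast+
      moreover have "?pr N t \<in> words N" using seg_in_words[OF x(1), of 0 "int N" N] pr[OF x(3)] by simp
      ultimately show ?thesis using x(5) by metis
    qed
    then obtain e' where e': "\<And>t. t \<in> F \<Longrightarrow> e' t \<noteq> e (?pr N t)"
      "\<And>t. t \<in> F \<Longrightarrow> e' t # ?pr N t \<in> words (Suc N)" by metis
    \<comment> \<open>\<open>?A\<close> contains one chosen left extension of every word,
      \<open>?B\<close> a different one of each left special prefix; this makes them
      disjoint.\<close>
    let ?A = "(\<lambda>w. e w # w) ` words N" and ?B = "(\<lambda>t. e' t # ?pr N t) ` F"
    have "card ?A = card (words N)" by (rule card_image) (simp add: inj_on_def)
    moreover have "card ?B = C + 1"
      using card_image[of "\<lambda>t. e' t # ?pr N t" F] inj[OF N] F(3) by (simp add: inj_on_def)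
    moreover have "?A \<inter> ?B = {}"
    proof -
      have "e w # w \<noteq> e' t # ?pr N t" if "t \<in> F" for w t using e'(1)[OF that] by auto
      then show ?thesis by blast
    qed
    moreover have "?A \<union> ?B \<subseteq> words (Suc N)" using e e'(2) by blast
    ultimately show ?thesis
      using card_mono[OF finite_words, of "?A \<union> ?B" "Suc N"]
        card_Un_disjoint[of ?A ?B] finite_words F(2) by simp
  qed
  have "k * (C + 1) \<le> card (words (N0 + k))" for k
  proof (induction k)
    case (Suc k)
    then show ?case using step[of "N0 + k"] by simp
  qed simp
  \<comment> \<open>For this \<open>k\<close> the lower bound exceeds the upper bound by exactly
    1.\<close>
  from this[of "C * N0 + 1"] C[of "N0 + (C * N0 + 1)"] show False
    by (simp add: algebra_simps)
qed

section \<open>Recognizability on bounded windows\<close>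

text \<open>The two sources are translates of each other, so their images differ by a translation
  \<open>c\<close> that fixes \<open>y\<close>, and \<open>c = 0\<close> by aperiodicity. Then
  blocks 0 and \<open>d\<close> of \<open>x\<close> both contain position 0, hence
  \<open>d = 0\<close>.\<close>

lemma centered_representation_unique:
  assumes x: "x \<in> X" "img \<sigma> x P y" "P 0 \<le> 0" "0 < P 1"
    and x': "x' \<in> X" "img \<sigma> x' P' y" "P' 0 \<le> 0" "0 < P' 1"
  shows "x = x'" "P = P'"
proof -
  obtain d where d: "\<And>i. x' i = x (i + d)"
    using same_orbit_if_same_image[OF x(1,2) x'(1,2)] by blast
  obtain c where c: "\<And>i. P (i + d) = P' i + c" "\<And>t. y (t + c) = y t"
    by (rule img_unique[OF x'(2) x(2) morph, of d]) (use d in auto)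
  have "c = 0" using aperiodic[OF img_in_X[OF x(1,2)] c(2)] .
  then have "d = 0"
    using img_block_unique[OF x(2), of d 0 0] c(1)[of 0] c(1)[of 1] x(3,4) x'(3,4)
    by (simp add: add.commute)
  with \<open>c = 0\<close> c(1) d show "x = x'" "P = P'" by (simp_all add: fun_eq_iff)
qed

text \<open>Counterexamples for growing \<open>L\<close> have limits that are two centred
  representations of the same sequence, hence equal. Convergence on the window of radius
  \<open>gap\<close> then contradicts the assumed disagreement.\<close>

lemma recognizability_window:
  "\<exists>L. \<forall>x\<in>X. \<forall>x'\<in>X. \<forall>P P' y y'. img \<sigma> x P y \<and> img \<sigma> x' P' y' \<and>
     P 0 \<le> 0 \<and> 0 < P 1 \<and> P' 0 \<le> 0 \<and> 0 < P' 1 \<and> (\<forall>t. \<bar>t\<bar> \<le> int L \<longrightarrow> y t = y' t) \<longrightarrow>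
     P 0 = P' 0 \<and> (\<forall>i. 0 \<le> i \<and> i \<le> int gap \<longrightarrow> x i = x' i)"
proof (rule ccontr)
  assume neg: "\<not> ?thesis"
  have "\<exists>x x' P P' y y'. x \<in> X \<and> x' \<in> X \<and> img \<sigma> x P y \<and> img \<sigma> x' P' y' \<and>
     P 0 \<le> 0 \<and> 0 < P 1 \<and> P' 0 \<le> 0 \<and> 0 < P' 1 \<and> (\<forall>t. \<bar>t\<bar> \<le> int L \<longrightarrow> y t = y' t) \<and>
     \<not> (P 0 = P' 0 \<and> (\<forall>i. 0 \<le> i \<and> i \<le> int gap \<longrightarrow> x i = x' i))" for L
    using neg by blast
  then obtain xs xs' Ps Ps' ys ys' where X: "\<And>n. xs n \<in> X" "\<And>n. xs' n \<in> X"
    and I: "\<And>n. img \<sigma> (xs n) (Ps n) (ys n)" "\<And>n. img \<sigma> (xs' n) (Ps' n) (ys' n)"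
    and P: "\<And>n. Ps n 0 \<le> 0" "\<And>n. 0 < Ps n 1" "\<And>n. Ps' n 0 \<le> 0" "\<And>n. 0 < Ps' n 1"
    and eq: "\<And>n t. \<bar>t\<bar> \<le> int n \<Longrightarrow> ys n t = ys' n t"
    and ne: "\<And>n. \<not> (Ps n 0 = Ps' n 0 \<and> (\<forall>i. 0 \<le> i \<and> i \<le> int gap \<longrightarrow> xs n i = xs' n i))"
    by metis
  obtain r x Q y where r: "strict_mono (r :: nat \<Rightarrow> nat)"
    and x: "x \<in> X" "img \<sigma> x Q y" "Q 0 \<le> 0" "0 < Q 1"
    and lim: "\<And>N. \<exists>K. \<forall>n\<ge>K. \<forall>i. \<bar>i\<bar> \<le> int N \<longrightarrow>
      xs (r n) i = x i \<and> Ps (r n) i = Q i \<and> ys (r n) i = y i"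
    by (rule image_limit[OF X(1) I(1) P(1,2)]) (rule that)
  obtain r' x' Q' y' where r': "strict_mono (r' :: nat \<Rightarrow> nat)"
    and x': "x' \<in> X" "img \<sigma> x' Q' y'" "Q' 0 \<le> 0" "0 < Q' 1"
    and lim': "\<And>N. \<exists>K. \<forall>n\<ge>K. \<forall>i. \<bar>i\<bar> \<le> int N \<longrightarrow>
      xs' (r (r' n)) i = x' i \<and> Ps' (r (r' n)) i = Q' i \<and> ys' (r (r' n)) i = y' i"
    by (rule image_limit[of "\<lambda>n. xs' (r n)" "\<lambda>n. Ps' (r n)" "\<lambda>n. ys' (r n)"],
      rule X(2), rule I(2), rule P(3), rule P(4), rule that)
  have far: "\<exists>n. N \<le> r (r' n) \<and> (\<forall>i. \<bar>i\<bar> \<le> int N \<longrightarrow>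
      xs (r (r' n)) i = x i \<and> Ps (r (r' n)) i = Q i \<and> ys (r (r' n)) i = y i \<and>
      xs' (r (r' n)) i = x' i \<and> Ps' (r (r' n)) i = Q' i \<and> ys' (r (r' n)) i = y' i)" for N
  proof -
    obtain K where K: "\<And>n i. n \<ge> K \<Longrightarrow> \<bar>i\<bar> \<le> int N \<Longrightarrow>
        xs (r n) i = x i \<and> Ps (r n) i = Q i \<and> ys (r n) i = y i"
      using lim by blast
    obtain K' where K': "\<And>n i. n \<ge> K' \<Longrightarrow> \<bar>i\<bar> \<le> int N \<Longrightarrow>
        xs' (r (r' n)) i = x' i \<and> Ps' (r (r' n)) i = Q' i \<and> ys' (r (r' n)) i = y' i"
      using lim' by blast
    define n where "n = max N (max K K')"
    have "n \<le> r' n" "r' n \<le> r (r' n)" by (rule seq_suble[OF r'], rule seq_suble[OF r])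
    then show ?thesis using K[of "r' n"] K'[of n] by (intro exI[of _ n]) (auto simp: n_def)
  qed
  have "y' t = y t" for t
  proof -
    obtain n where n: "nat \<bar>t\<bar> \<le> r (r' n)" "ys (r (r' n)) t = y t" "ys' (r (r' n)) t = y' t"
      using far[of "nat \<bar>t\<bar>"] by auto
    then show ?thesis using eq[of t "r (r' n)"] by simp
  qed
  then have "y' = y" by blast
  then have same: "x = x'" "Q = Q'"
    using centered_representation_unique[OF x, of x' Q'] x' by simp_all
  obtain n where n: "\<And>i. \<bar>i\<bar> \<le> int gap \<Longrightarrow>
      xs (r (r' n)) i = x i \<and> Ps (r (r' n)) i = Q i \<and> xs' (r (r' n)) i = x' i \<and> Ps' (r (r' n)) i = Q' i"
    using far[of gap] by blast
  then show False using ne[of "r (r' n)"] same by simp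
qed

text \<open>Around any position at or beyond \<open>L\<close>, the recognizability window lies where
  \<open>y\<close> and \<open>y'\<close> agree, so the blocks there correspond and the agreement
  continues to the right. Followed to the left, it must stop after block 0, because the two
  representations differ.\<close>

lemma representations_merge:
  "\<exists>L. \<forall>u\<in>X. \<forall>u'\<in>X. \<forall>P P' y y'. img \<sigma> u P y \<and> img \<sigma> u' P' y' \<and>
     P 0 \<le> 0 \<and> 0 < P 1 \<and> P' 0 \<le> 0 \<and> 0 < P' 1 \<and> (\<forall>t\<ge>0. y t = y' t) \<and>
     (right_half u, P 0) \<noteq> (right_half u', P' 0) \<longrightarrow>
     (\<exists>i j. 0 < P i \<and> P i \<le> int L \<and> (\<forall>s. u (i + int s) = u' (j + int s)) \<and> u (i - 1) \<noteq> u' (j - 1))"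
proof -
  obtain L where L: "\<And>x x' P P' y y'. x \<in> X \<Longrightarrow> x' \<in> X \<Longrightarrow> img \<sigma> x P y \<Longrightarrow> img \<sigma> x' P' y' \<Longrightarrow>
     P 0 \<le> 0 \<Longrightarrow> 0 < P 1 \<Longrightarrow> P' 0 \<le> 0 \<Longrightarrow> 0 < P' 1 \<Longrightarrow> (\<And>t. \<bar>t\<bar> \<le> int L \<Longrightarrow> y t = y' t) \<Longrightarrow>
     P 0 = P' 0 \<and> (\<forall>i. 0 \<le> i \<and> i \<le> int gap \<longrightarrow> x i = x' i)"
    using recognizability_window by blast
  have "\<exists>i j. 0 < P i \<and> P i \<le> int L \<and> (\<forall>s. u (i + int s) = u' (j + int s)) \<and> u (i - 1) \<noteq> u' (j - 1)"
    if u: "u \<in> X" "img \<sigma> u P y" "P 0 \<le> 0" "0 < P 1"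
      and u': "u' \<in> X" "img \<sigma> u' P' y'" "P' 0 \<le> 0" "0 < P' 1"
      and yy: "\<And>t. 0 \<le> t \<Longrightarrow> y t = y' t" and ne: "(right_half u, P 0) \<noteq> (right_half u', P' 0)"
    for u u' P P' y y'
  proof -
    have W: "P q = P' q'" "\<And>s. s \<le> gap \<Longrightarrow> u (q + int s) = u' (q' + int s)"
      if t: "int L \<le> t" "P q \<le> t" "t < P (q + 1)" "P' q' \<le> t" "t < P' (q' + 1)" for q q' t
    proof -
      have "P (0 + q) - t = P' (0 + q') - t \<and>
          (\<forall>i. 0 \<le> i \<and> i \<le> int gap \<longrightarrow> u (i + q) = u' (i + q'))"
        by (rule L[OF X_shift[OF u(1)] X_shift[OF u'(1)]
              img_shift_target[OF img_shift_source[OF u(2)]]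
              img_shift_target[OF img_shift_source[OF u'(2)]]])
          (use t yy in \<open>auto simp: add.commute\<close>)
      then show "P q = P' q'" "\<And>s. s \<le> gap \<Longrightarrow> u (q + int s) = u' (q' + int s)"
        by (auto simp: add.commute[of q] add.commute[of q'])
    qed
    obtain i0 where i0: "P i0 \<le> int L" "int L < P (i0 + 1)" by (rule img_blockE[OF u(2)])
    obtain j0 where j0: "P' j0 \<le> int L" "int L < P' (j0 + 1)" by (rule img_blockE[OF u'(2)])
    note W0 = W[OF order_refl i0 j0]
    \<comment> \<open>The letter at \<open>i0 + int s\<close> may be erased and then has no position
      of its own to centre at. It is reached from the window of a nonerased letter \<open>q\<close>
      at most \<open>gap\<close> to its left, or, if \<open>q \<le> i0\<close>, from the window at
      \<open>L\<close>.\<close>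
    have agree: "P (i0 + int s) = P' (j0 + int s) \<and> u (i0 + int s) = u' (j0 + int s)" for s
    proof (induction s rule: less_induct)
      case (less s)
      show ?case
      proof (cases s)
        case 0
        then show ?thesis using W0(1) W0(2)[of 0] by simp
      next
        case (Suc s')
        have "P (i0 + int s' + 1) = P' (j0 + int s' + 1)"
          using less[of s'] Suc img_step[OF u(2), of "i0 + int s'"] img_step[OF u'(2), of "j0 + int s'"]
          by simp
        then have P: "P (i0 + int s) = P' (j0 + int s)" using Suc by (simp add: algebra_simps)
        obtain q where q: "i0 + int s - int gap \<le> q" "q < i0 + int s" "\<sigma> [u q] \<noteq> []"
          using nonerased_gap[OF u(1), of "i0 + int s - int gap"] by auto
        show ?thesis
        proof (cases "q \<le> i0")
          case True
          then show ?thesis using P W0(2)[of s] q(1) by simp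
        next
          case False
          define p where "p = nat (q - i0)"
          have p: "q = i0 + int p" "p < s" using False q by (auto simp: p_def)
          have IH: "P q = P' (j0 + int p)" "u q = u' (j0 + int p)" using less[OF p(2)] p(1) by auto
          have "int L \<le> P q" using i0(2) img_mono[OF u(2), of "i0 + 1" q] False by simp
          moreover have "P q < P (q + 1)" using img_step[OF u(2), of q] q(3) by simp
          moreover have "P q < P' (j0 + int p + 1)"
            using img_step[OF u'(2), of "j0 + int p"] q(3) IH by simp
          ultimately have "u (q + int (s - p)) = u' (j0 + int p + int (s - p))"
            using W(2)[of "P q" q "j0 + int p" "s - p"] IH p q(1) by simp
          then show ?thesis using P p by simp
        qed
      qed
    qed
    have "0 \<le> i0" using img_less_cancel[OF u(2), of 0 "i0 + 1"] u(3) i0(2) by simp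
    define tail where "tail e \<longleftrightarrow> (\<forall>s. u (i0 - int e + int s) = u' (j0 - int e + int s))" for e
    \<comment> \<open>The cuts already agree to the right of \<open>i0\<close> and
      \<open>j0\<close>; equal letters carry this agreement back to the left.\<close>
    have tailP: "P (i0 - int e + int s) = P' (j0 - int e + int s)" if "tail e" for e s
    proof -
      have eq: "u (i + (i0 - j0)) = u' i" if "j0 - int e \<le> i" for i
        using \<open>tail e\<close>[unfolded tail_def, rule_format, of "nat (i - (j0 - int e))"] that
        by (simp add: algebra_simps)
      let ?b = "max j0 (j0 - int e + int s)"
      have "P (?b + (i0 - j0)) = P' ?b"
        using agree[of "nat (?b - j0)"] by (simp add: algebra_simps)
      moreover have "P (?b + (i0 - j0)) - P (j0 - int e + int s + (i0 - j0)) = P' ?b - P' (j0 - int e + int s)"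
        by (rule img_local(1)[OF u'(2) u(2) morph]) (use eq in auto)
      ultimately show ?thesis by (simp add: algebra_simps)
    qed
    have t0: "tail 0" using agree by (simp add: tail_def)
    \<comment> \<open>Otherwise block 0 of \<open>u\<close> would be block \<open>d\<close> of
      \<open>u'\<close>. Both contain position 0, so \<open>d = 0\<close>, and the two
      representations would coincide.\<close>
    have "\<not> tail (nat i0)"
    proof
      assume tl: "tail (nat i0)"
      define d where "d = j0 - i0"
      have e: "P 0 = P' d" "P 1 = P' (d + 1)"
        using tailP[OF tl, of 0] tailP[OF tl, of 1] \<open>0 \<le> i0\<close> by (simp_all add: d_def)
      then have "d = 0" using img_block_unique[OF u'(2), of d 0 0] u(3,4) u'(3,4) by simp
      then have "right_half u = right_half u'"
        using tl \<open>0 \<le> i0\<close> by (simp add: tail_def right_half_def d_def fun_eq_iff)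
      with e(1) \<open>d = 0\<close> ne show False by simp
    qed
    then obtain e where e: "e < nat i0" "tail e" "\<not> tail (Suc e)"
      using t0 by (metis dec_induct le0 linorder_not_le less_or_eq_imp_le nat_less_le order_refl)
    define i where "i = i0 - int e"
    define j where "j = j0 - int e"
    have i: "1 \<le> i" "i \<le> i0" using e(1) by (auto simp: i_def)
    have tl: "\<forall>s. u (i + int s) = u' (j + int s)" using e(2) by (simp add: tail_def i_def j_def)
    have "u (i - 1) \<noteq> u' (j - 1)"
    proof
      assume eq: "u (i - 1) = u' (j - 1)"
      have "u (i - 1 + int s) = u' (j - 1 + int s)" for s
        using eq tl[rule_format, of "s - 1"] by (cases s) (auto simp: algebra_simps)
      then have "tail (Suc e)" by (simp add: tail_def i_def j_def algebra_simps)
      with e(3) show False ..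
    qed
    moreover have "0 < P i" using img_mono[OF u(2) i(1)] u(4) by simp
    moreover have "P i \<le> int L" using img_mono[OF u(2) i(2)] i0(1) by simp
    ultimately show ?thesis using tl by blast
  qed
  then show ?thesis by blast
qed

section \<open>One-sided representations and exceptional points\<close>

lemma representation_img:
  assumes u: "u \<in> X" and rep: "sigma_representation \<sigma> y (right_half u, k)"
  obtains P z where "img \<sigma> u P z" "P 0 = - int k" "0 < P 1" "\<And>n. z (int n) = y n"
proof -
  obtain s where k: "k < length (\<sigma> [u 0])" and s: "seq_image \<sigma> (right_half u) s"
    and y: "\<And>n. y n = s (n + k)"
    using rep by (auto simp: sigma_representation_def right_half_def seq_shift_funpow_nat)
  \<comment> \<open>With this normalization, position 0 of \<open>z\<close> is the letter with index
    \<open>k\<close> in the image of \<open>u 0\<close>, where \<open>y\<close> begins.\<close>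
  obtain P z where P: "img \<sigma> u P z" "P 0 = - int k" by (rule image_exists[OF u])
  have "0 < P 1" using img_step[OF P(1), of 0] P(2) k by simp
  moreover have "z (int n) = y n" for n
  proof -
    obtain j where j: "int n < P j" using P(1) unfolding img_def by blast
    define m where "m = nat j"
    have "P j \<le> P (int m)" by (rule img_mono[OF P(1)]) (simp add: m_def)
    with j have m: "int n < P (int m)" by linarith
    have "image_prefix \<sigma> (right_half u) m = \<sigma> (seg u 0 (int m))"
      unfolding image_prefix_def map_upt_eq_seg[of u 0 m, simplified, symmetric]
        word_morphism_concat[OF morph, of "map _ _"]
      by (simp add: right_half_def o_def)
    then have e: "map s [0..<length (\<sigma> (seg u 0 (int m)))] = seg z (P 0) (P (int m))"
      using s img_seg[OF P(1) morph, of 0 "int m"] unfolding seq_image_def by (metis of_nat_0_le_iff)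
    have "length (\<sigma> (seg u 0 (int m))) = nat (P (int m) - P 0)"
      using arg_cong[OF e, of length] by simp
    then have "s (n + k) = seg z (P 0) (P (int m)) ! (n + k)"
      unfolding e[symmetric] using m P(2) by simp
    then show ?thesis using m P(2) by (simp add: nth_seg y)
  qed
  ultimately show ?thesis using P that by blast
qed

text \<open>A point with two representations is a word of length at most \<open>L\<close> followed
  by the image of a left special sequence, the common continuation after the merging point. There
  are finitely many such pairs, and each determines the point.\<close>

theorem almost_recognizable: "almost_one_sided_recognizable \<sigma> (right_half ` X)"
  unfolding almost_one_sided_recognizable_def
proof -
  let ?NR = "{y. \<not> one_sided_recognizable_at \<sigma> (right_half ` X) y}"
  \<comment> \<open>Expresses that \<open>y\<close> is the word \<open>fst wt\<close> followed by
    the image of \<open>snd wt\<close>, by means of a two-sided extension \<open>u\<close> of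
    \<open>snd wt\<close>.\<close>
  define rel where "rel y wt \<longleftrightarrow> (\<exists>u P z i. img \<sigma> u P z \<and> (\<forall>n. z (int n) = y n) \<and>
      P i = int (length (fst wt)) \<and> fst wt = map y [0..<length (fst wt)] \<and>
      (\<forall>n. u (i + int n) = snd wt n))" for y wt
  obtain L where L: "\<And>u u' P P' y y'. u \<in> X \<Longrightarrow> u' \<in> X \<Longrightarrow> img \<sigma> u P y \<Longrightarrow> img \<sigma> u' P' y' \<Longrightarrow>
     P 0 \<le> 0 \<Longrightarrow> 0 < P 1 \<Longrightarrow> P' 0 \<le> 0 \<Longrightarrow> 0 < P' 1 \<Longrightarrow> (\<And>t. 0 \<le> t \<Longrightarrow> y t = y' t) \<Longrightarrow>
     (right_half u, P 0) \<noteq> (right_half u', P' 0) \<Longrightarrow>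
     \<exists>i j. 0 < P i \<and> P i \<le> int L \<and> (\<forall>s. u (i + int s) = u' (j + int s)) \<and> u (i - 1) \<noteq> u' (j - 1)"
    using representations_merge by blast
  let ?F = "{w :: 'a list. length w \<le> L} \<times> left_special"
  have ex: "\<exists>wt\<in>?F. rel y wt" if y: "y \<in> ?NR" for y
  proof -
    obtain u u' k k' where u: "u \<in> X" "u' \<in> X" "sigma_representation \<sigma> y (right_half u, k)"
      "sigma_representation \<sigma> y (right_half u', k')" "(right_half u, k) \<noteq> (right_half u', k')"
      using y unfolding one_sided_recognizable_at_def by blast
    obtain P z where P: "img \<sigma> u P z" "P 0 = - int k" "0 < P 1" "\<And>n. z (int n) = y n"
      by (rule representation_img[OF u(1,3)]) (rule that)
    obtain P' z' where P': "img \<sigma> u' P' z'" "P' 0 = - int k'" "0 < P' 1" "\<And>n. z' (int n) = y n"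
      by (rule representation_img[OF u(2,4)]) (rule that)
    have zz: "z t = z' t" if "0 \<le> t" for t using P(4)[of "nat t"] P'(4)[of "nat t"] that by simp
    have "\<exists>i j. 0 < P i \<and> P i \<le> int L \<and> (\<forall>s. u (i + int s) = u' (j + int s)) \<and> u (i - 1) \<noteq> u' (j - 1)"
      by (rule L[OF u(1,2) P(1) P'(1)]) (use P P' u(5) zz in auto)
    then obtain i j where i: "0 < P i" "P i \<le> int L" "\<And>s. u (i + int s) = u' (j + int s)"
      "u (i - 1) \<noteq> u' (j - 1)" by blast
    define t where "t n = u (i + int n)" for n
    have "t \<in> left_special"
      unfolding left_special_def
    proof (rule CollectI, intro bexI conjI)
      show "right_half (\<lambda>n. u (n + i)) = t" "right_half (\<lambda>n. u' (n + j)) = t"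
        using i(3) by (simp_all add: right_half_def t_def fun_eq_iff add.commute)
      show "u (- 1 + i) \<noteq> u' (- 1 + j)" using i(4) by simp
    qed (use X_shift u in auto)
    moreover define w where "w = map y [0..<nat (P i)]"
    ultimately have "(w, t) \<in> ?F" using i(2) by simp
    moreover have "rel y (w, t)"
      unfolding rel_def using P(1,4) i(1) by (intro exI[of _ u] exI[of _ P] exI[of _ z] exI[of _ i])
        (simp add: w_def t_def)
    ultimately show ?thesis by blast
  qed
  have uniq: "y = y'" if y: "rel y wt" and y': "rel y' wt" for y y' wt
  proof
    fix n
    obtain w t where wt: "wt = (w, t)" by fastforce
    obtain u P z i where u: "img \<sigma> u P z" "\<And>n. z (int n) = y n" "P i = int (length w)"
      "w = map y [0..<length w]" "\<And>n. u (i + int n) = t n"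
      using y unfolding rel_def wt by auto
    obtain u' P' z' i' where u': "img \<sigma> u' P' z'" "\<And>n. z' (int n) = y' n" "P' i' = int (length w)"
      "w = map y' [0..<length w]" "\<And>n. u' (i' + int n) = t n"
      using y' unfolding rel_def wt by auto
    show "y n = y' n"
    proof (cases "n < length w")
      case True
      then show ?thesis using u(4) u'(4) by (metis nth_map_upt add_0 diff_zero)
    next
      case False
      obtain b where b: "int n < P b" using u(1) unfolding img_def by blast
      have "int n < P (max i b)" using b img_mono[OF u(1), of b "max i b"] by simp
      moreover have "u' (k + (i' - i)) = u k" if "i \<le> k" for k
        using u(5)[of "nat (k - i)"] u'(5)[of "nat (k - i)"] that by (simp add: algebra_simps)
      ultimately have "z' (int n + (P' (i + (i' - i)) - P i)) = z (int n)"
        using False u(3) by (intro img_local(2)[OF u(1) u'(1) morph, of i "max i b"]) auto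
      then show ?thesis using u(2,3) u'(2,3) by simp
    qed
  qed
  obtain \<phi> where \<phi>: "\<And>y. y \<in> ?NR \<Longrightarrow> \<phi> y \<in> ?F" "\<And>y. y \<in> ?NR \<Longrightarrow> rel y (\<phi> y)"
    using ex by metis
  have "finite ?F"
    using finite_lists_length_le[of "UNIV :: 'a set" L] finite_left_special by simp
  moreover have "\<phi> ` ?NR \<subseteq> ?F" using \<phi>(1) by blast
  moreover have "inj_on \<phi> ?NR" by (rule inj_onI) (metis \<phi>(2) uniq)
  ultimately show "finite ?NR" by (meson finite_subset finite_imageD)
qed

end

theorem theorem4p7:
  fixes \<sigma> :: "'a::finite list \<Rightarrow> 'a list"
  assumes "word_morphism \<sigma>"
    and "minimal_shift (morphism_shift \<sigma>)"
    and "aperiodic_shift (morphism_shift \<sigma>)"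
  shows "almost_one_sided_recognizable \<sigma> (right_half ` morphism_shift \<sigma>)"
proof (cases "\<exists>x\<in>morphism_shift \<sigma>. \<exists>i. \<sigma> [x i] \<noteq> []")
  case True
  then interpret minimal_morphism \<sigma> "morphism_shift \<sigma>"
    using assms by unfold_locales
  show ?thesis by (rule almost_recognizable)
next
  case False
  \<comment> \<open>All letters occurring in the shift are erased, so no \<open>k\<close> lies below
    \<open>length (\<sigma> [x 0])\<close> and no sequence has a representation.\<close>
  then have "one_sided_recognizable_at \<sigma> (right_half ` morphism_shift \<sigma>) y" for y
    by (auto simp: one_sided_recognizable_at_def sigma_representation_def right_half_def)
  then show ?thesis by (simp add: almost_one_sided_recognizable_def)
qed

end
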